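(* There exist a proper, geodesic, Gromov-hyperbolic metric space $X$ with bounded geometry, which is not line-convex, and a discrete, non-elementary, cocompact, torsion-free group $\Gamma<\mathrm{Isom}(X)$ such that $$h_{\mathrm{top}}(\Gamma\backslash\mathrm{Geod}(X),\bar\Phi_1)>h_{\mathrm{crit}}(X;\Gamma).$$
   Context: Let $(X,d)$ be a metric space. $X$ is proper if closed balls are compact. A geodesic line is an isometric embedding $\gamma\colon\mathbb{R}\to X$. $X$ is line-convex if for every two geodesic lines $\gamma,\gamma'$ the function $t\mapsto d(\gamma(t),\gamma'(t))$ is convex on $\mathbb{R}$. $X$ is Gromov-hyperbolic if there is $\delta\ge 0$ such that $(x,z)_w\ge\min\{(x,y)_w,(y,z)_w\}-\delta$ for all $x,y,z,w\in X$, where $(y,z)_x=\frac12(d(x,y)+d(x,z)-d(y,z))$. $\partial X$ is the Gromov boundary. $X$ has bounded geometry if $\sup_{x\in X}\mathrm{Cov}(\overline B(x,R),r)<+\infty$ for every $0<r\le R$, where $\mathrm{Cov}(B,r)$ is the minimal number of balls of radius $r$ needed to cover $B$. $\Gamma<\mathrm{Isom}(X)$ is discrete if for all $x\in X$, $R\ge0$ the set $\{g\in\Gamma: d(x,gx)\le R\}$ is finite; cocompact if $\Gamma\backslash X$ is compact; non-elementary if its limit set $\Lambda(\Gamma)\subseteq\partial X$ (accumulation points of an orbit $\Gamma x$) has more than 2 points. The critical exponent is $h_{\mathrm{crit}}(X;\Gamma)=\limsup_{T\to+\infty}\frac1T\log\#(\Gamma x\cap B(x,T))$, for any $x\in X$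 (independent of $x$). $\mathrm{Geod}(X)$ is the space of geodesic lines of $X$ with the topology of uniform convergence on compact subsets of $\mathbb{R}$, and $(\Phi_t\gamma)(\cdot)=\gamma(\cdot+t)$. $\Gamma$ acts by $(g\gamma)(\cdot)=g\gamma(\cdot)$, commuting with $\Phi_t$; $\bar\Phi_t$ is the induced action on $\Gamma\backslash\mathrm{Geod}(X)$. For a metrizable space $Y$ and continuous $T\colon Y\to Y$, $$h_{\mathrm{top}}(Y,T)=\inf_{\rho}\sup_K\lim_{r\to0}\limsup_{n\to+\infty}\frac1n\log\mathrm{Cov}_{\rho^n}(K,r),$$ where $\rho$ ranges over metrics inducing the topology of $Y$, $K$ over compact subsets of $Y$, $\rho^n(y,y')=\max_{0\le i\le n-1}\rho(T^iy,T^iy')$, and $\mathrm{Cov}_{\rho^n}(K,r)$ is the minimal number of $\rho^n$-balls of radius $r$ needed to cover $K$. *)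

theory Defs
  imports "HOL-Analysis.Analysis" "HOL-Algebra.Group_Action"
begin

text \<open>
  Metric spaces are given by a carrier \<open>M\<close> and a distance \<open>d\<close>, as in the locale
  \<^locale>\<open>Metric_space\<close>; outside \<open>M\<close> the locale only asks \<open>d\<close> to be
  nonnegative and symmetric, and no notion below depends on its values there.
\<close>

section \<open>Metric notions\<close>

definition proper_metric :: "'a set \<Rightarrow> ('a \<Rightarrow> 'a \<Rightarrow> real) \<Rightarrow> bool" where
  "proper_metric M d \<longleftrightarrow>
     (\<forall>x\<in>M. \<forall>r. compactin (Metric_space.mtopology M d) (Metric_space.mcball M d x r))"

definition geodesic_metric :: "'a set \<Rightarrow> ('a \<Rightarrow> 'a \<Rightarrow> real) \<Rightarrow> bool" where
  "geodesic_metric M d \<longleftrightarrow>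
     (\<forall>x\<in>M. \<forall>y\<in>M. \<exists>c :: real \<Rightarrow> 'a. c ` {0..d x y} \<subseteq> M \<and> c 0 = x \<and> c (d x y) = y \<and>
        (\<forall>s\<in>{0..d x y}. \<forall>t\<in>{0..d x y}. d (c s) (c t) = \<bar>s - t\<bar>))"

definition geodesic_lines :: "'a set \<Rightarrow> ('a \<Rightarrow> 'a \<Rightarrow> real) \<Rightarrow> (real \<Rightarrow> 'a) set" where
  "geodesic_lines M d = {c. range c \<subseteq> M \<and> (\<forall>s t. d (c s) (c t) = \<bar>s - t\<bar>)}"

definition line_convex :: "'a set \<Rightarrow> ('a \<Rightarrow> 'a \<Rightarrow> real) \<Rightarrow> bool" where
  "line_convex M d \<longleftrightarrow>
     (\<forall>c\<in>geodesic_lines M d. \<forall>c'\<in>geodesic_lines M d. convex_on UNIV (\<lambda>t. d (c t) (c' t)))"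

text \<open>\<open>gromov_product d w x y\<close> is the product of \<open>x\<close> and \<open>y\<close> seen from the base point \<open>w\<close>.\<close>

definition gromov_product :: "('a \<Rightarrow> 'a \<Rightarrow> real) \<Rightarrow> 'a \<Rightarrow> 'a \<Rightarrow> 'a \<Rightarrow> real" where
  "gromov_product d w x y = (d w x + d w y - d x y) / 2"

definition gromov_hyperbolic :: "'a set \<Rightarrow> ('a \<Rightarrow> 'a \<Rightarrow> real) \<Rightarrow> bool" where
  "gromov_hyperbolic M d \<longleftrightarrow>
     (\<exists>\<delta>\<ge>0. \<forall>x\<in>M. \<forall>y\<in>M. \<forall>z\<in>M. \<forall>w\<in>M.
        gromov_product d w x z \<ge> min (gromov_product d w x y) (gromov_product d w y z) - \<delta>)"

text \<open>
  Minimal number of open \<open>d\<close>-balls of radius \<open>r\<close>, with centres anywhere in \<open>M\<close>, needed to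
  cover \<open>S\<close>; it is \<open>\<infinity>\<close> if no finite family suffices.
\<close>

definition covering_number :: "'a set \<Rightarrow> ('a \<Rightarrow> 'a \<Rightarrow> real) \<Rightarrow> 'a set \<Rightarrow> real \<Rightarrow> enat" where
  "covering_number M d S r =
     Inf {enat (card C) | C. finite C \<and> C \<subseteq> M \<and> S \<subseteq> (\<Union>c\<in>C. Metric_space.mball M d c r)}"

definition bounded_geometry :: "'a set \<Rightarrow> ('a \<Rightarrow> 'a \<Rightarrow> real) \<Rightarrow> bool" where
  "bounded_geometry M d \<longleftrightarrow>
     (\<forall>r R. 0 < r \<and> r \<le> R \<longrightarrow>
        (SUP x\<in>M. covering_number M d (Metric_space.mcball M d x R) r) < \<infinity>)"

section \<open>The Gromov boundary\<close>

text \<open>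
  Boundary points are equivalence classes of sequences converging to infinity; a sequence in
  \<open>M\<close> converges to the boundary point \<open>z\<close> iff it belongs to the class \<open>z\<close>. In a hyperbolic
  space the conditions below do not depend on the base point \<open>w\<close>.
\<close>

definition gromov_asymptotic ::
    "'a set \<Rightarrow> ('a \<Rightarrow> 'a \<Rightarrow> real) \<Rightarrow> (nat \<Rightarrow> 'a) \<Rightarrow> (nat \<Rightarrow> 'a) \<Rightarrow> bool" where
  "gromov_asymptotic M d s s' \<longleftrightarrow>
     (\<forall>w\<in>M. filterlim (\<lambda>(m, n). gromov_product d w (s m) (s' n)) at_top
        (sequentially \<times>\<^sub>F sequentially))"

definition gromov_sequences :: "'a set \<Rightarrow> ('a \<Rightarrow> 'a \<Rightarrow> real) \<Rightarrow> (nat \<Rightarrow> 'a) set" where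
  "gromov_sequences M d = {s. range s \<subseteq> M \<and> gromov_asymptotic M d s s}"

definition gromov_boundary :: "'a set \<Rightarrow> ('a \<Rightarrow> 'a \<Rightarrow> real) \<Rightarrow> (nat \<Rightarrow> 'a) set set" where
  "gromov_boundary M d =
     gromov_sequences M d //
       {(s, s'). s \<in> gromov_sequences M d \<and> s' \<in> gromov_sequences M d \<and> gromov_asymptotic M d s s'}"

section \<open>Groups of isometries\<close>

text \<open>
  As for \<^const>\<open>BijGroup\<close>, the elements are extensional functions, so that an isometry
  of the carrier is represented by exactly one function.
\<close>

definition isom_group :: "'a set \<Rightarrow> ('a \<Rightarrow> 'a \<Rightarrow> real) \<Rightarrow> ('a \<Rightarrow> 'a) monoid" where
  "isom_group M d =
     (BijGroup M)\<lparr>carrier := {g \<in> Bij M. \<forall>x\<in>M. \<forall>y\<in>M. d (g x) (g y) = d x y}\<rparr>"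

lemma group_isom_group: "group (isom_group M d)"
proof -
  interpret B: group "BijGroup M" by (rule group_BijGroup)
  let ?I = "{g \<in> Bij M. \<forall>x\<in>M. \<forall>y\<in>M. d (g x) (g y) = d x y}"
  have "subgroup ?I (BijGroup M)"
  proof (rule B.subgroupI)
    show "?I \<subseteq> carrier (BijGroup M)" by (auto simp: BijGroup_def)
    have "(\<lambda>x\<in>M. x) \<in> ?I" by (auto simp: id_Bij)
    then show "?I \<noteq> {}" by blast
  next
    fix g assume g: "g \<in> ?I"
    have inv: "inv\<^bsub>BijGroup M\<^esub> g = (\<lambda>x\<in>M. inv_into M g x)"
      using g by (simp add: inv_BijGroup)
    have "bij_betw g M M" using g by (auto simp: Bij_def)
    then have h: "inv_into M g x \<in> M" "g (inv_into M g x) = x" if "x \<in> M" for x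
      using that by (auto simp: bij_betw_def inv_into_into f_inv_into_f)
    have "d (inv_into M g x) (inv_into M g y) = d x y" if "x \<in> M" "y \<in> M" for x y
      using g h[OF that(1)] h[OF that(2)] by (metis (mono_tags, lifting) mem_Collect_eq)
    then show "inv\<^bsub>BijGroup M\<^esub> g \<in> ?I"
      using g by (auto simp: inv restrict_inv_into_Bij)
  next
    fix g h assume gh: "g \<in> ?I" "h \<in> ?I"
    then have "h x \<in> M" if "x \<in> M" for x
      using that by (auto dest: Bij_imp_funcset)
    then show "g \<otimes>\<^bsub>BijGroup M\<^esub> h \<in> ?I"
      using gh by (auto simp: BijGroup_def compose_Bij compose_eq)
  qed
  then show ?thesis
    unfolding isom_group_def by (rule B.subgroup_imp_group)
qed

abbreviation isom_subgroup ::
    "'a set \<Rightarrow> ('a \<Rightarrow> 'a \<Rightarrow> real) \<Rightarrow> ('a \<Rightarrow> 'a) set \<Rightarrow> ('a \<Rightarrow> 'a) monoid" where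
  "isom_subgroup M d \<Gamma> \<equiv> (isom_group M d)\<lparr>carrier := \<Gamma>\<rparr>"

abbreviation isom_orbit ::
    "'a set \<Rightarrow> ('a \<Rightarrow> 'a \<Rightarrow> real) \<Rightarrow> ('a \<Rightarrow> 'a) set \<Rightarrow> 'a \<Rightarrow> 'a set" where
  "isom_orbit M d \<Gamma> \<equiv> orbit (isom_subgroup M d \<Gamma>) (\<lambda>g. g)"

definition torsion_free :: "('a, 'b) monoid_scheme \<Rightarrow> bool" where
  "torsion_free G \<longleftrightarrow>
     (\<forall>g\<in>carrier G. \<forall>n::nat. n > 0 \<and> g [^]\<^bsub>G\<^esub> n = \<one>\<^bsub>G\<^esub> \<longrightarrow> g = \<one>\<^bsub>G\<^esub>)"

definition discrete_isoms :: "'a set \<Rightarrow> ('a \<Rightarrow> 'a \<Rightarrow> real) \<Rightarrow> ('a \<Rightarrow> 'a) set \<Rightarrow> bool" where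
  "discrete_isoms M d \<Gamma> \<longleftrightarrow> (\<forall>x\<in>M. \<forall>R\<ge>0. finite {g\<in>\<Gamma>. d x (g x) \<le> R})"

definition limit_set ::
    "'a set \<Rightarrow> ('a \<Rightarrow> 'a \<Rightarrow> real) \<Rightarrow> ('a \<Rightarrow> 'a) set \<Rightarrow> 'a \<Rightarrow> (nat \<Rightarrow> 'a) set set" where
  "limit_set M d \<Gamma> x = {z \<in> gromov_boundary M d. \<exists>s\<in>z. range s \<subseteq> isom_orbit M d \<Gamma> x}"

definition non_elementary :: "'a set \<Rightarrow> ('a \<Rightarrow> 'a \<Rightarrow> real) \<Rightarrow> ('a \<Rightarrow> 'a) set \<Rightarrow> bool" where
  "non_elementary M d \<Gamma> \<longleftrightarrow>
     (\<forall>x\<in>M. \<not> (finite (limit_set M d \<Gamma> x) \<and> card (limit_set M d \<Gamma> x) \<le> 2))"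

text \<open>For a discrete group the sets counted here are finite.\<close>

definition critical_exponent ::
    "'a set \<Rightarrow> ('a \<Rightarrow> 'a \<Rightarrow> real) \<Rightarrow> ('a \<Rightarrow> 'a) set \<Rightarrow> 'a \<Rightarrow> ereal" where
  "critical_exponent M d \<Gamma> x =
     Limsup at_top (\<lambda>T::real.
       ereal (1 / T * ln (real (card (isom_orbit M d \<Gamma> x \<inter> Metric_space.mball M d x T)))))"

section \<open>Quotient spaces\<close>

definition quotient_topology :: "'a topology \<Rightarrow> ('a \<Rightarrow> 'b) \<Rightarrow> 'b topology" where
  "quotient_topology Y q =
     topology (\<lambda>U. U \<subseteq> q ` topspace Y \<and> openin Y {y \<in> topspace Y. q y \<in> U})"

lemma openin_quotient_topology:
  "openin (quotient_topology Y q) U \<longleftrightarrow>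
     U \<subseteq> q ` topspace Y \<and> openin Y {y \<in> topspace Y. q y \<in> U}"
proof -
  have "istopology (\<lambda>U. U \<subseteq> q ` topspace Y \<and> openin Y {y \<in> topspace Y. q y \<in> U})"
  proof (unfold istopology_def, intro conjI allI impI; (elim conjE)?)
    fix S T
    assume "S \<subseteq> q ` topspace Y" "openin Y {y \<in> topspace Y. q y \<in> S}"
      "openin Y {y \<in> topspace Y. q y \<in> T}"
    moreover have "{y \<in> topspace Y. q y \<in> S \<inter> T} =
        {y \<in> topspace Y. q y \<in> S} \<inter> {y \<in> topspace Y. q y \<in> T}" by auto
    ultimately show "S \<inter> T \<subseteq> q ` topspace Y" "openin Y {y \<in> topspace Y. q y \<in> S \<inter> T}"
      by (auto intro: openin_Int)
  next
    fix K
    assume K: "\<forall>S\<in>K. S \<subseteq> q ` topspace Y \<and> openin Y {y \<in> topspace Y. q y \<in> S}"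
    then show "\<Union>K \<subseteq> q ` topspace Y" by blast
    have "{y \<in> topspace Y. q y \<in> \<Union>K} = (\<Union>S\<in>K. {y \<in> topspace Y. q y \<in> S})" by auto
    with K show "openin Y {y \<in> topspace Y. q y \<in> \<Union>K}" by auto
  qed
  then show ?thesis by (simp add: quotient_topology_def)
qed

lemma topspace_quotient_topology: "topspace (quotient_topology Y q) = q ` topspace Y"
proof
  show "topspace (quotient_topology Y q) \<subseteq> q ` topspace Y"
    by (auto simp: topspace_def openin_quotient_topology)
  have "{y \<in> topspace Y. q y \<in> q ` topspace Y} = topspace Y" by auto
  then have "openin (quotient_topology Y q) (q ` topspace Y)"
    by (simp add: openin_quotient_topology)
  then show "q ` topspace Y \<subseteq> topspace (quotient_topology Y q)" by (rule openin_subset)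
qed

lemma quotient_map_quotient_topology: "quotient_map Y (quotient_topology Y q) q"
  by (auto simp: quotient_map_def openin_quotient_topology topspace_quotient_topology)

definition cocompact :: "'a set \<Rightarrow> ('a \<Rightarrow> 'a \<Rightarrow> real) \<Rightarrow> ('a \<Rightarrow> 'a) set \<Rightarrow> bool" where
  "cocompact M d \<Gamma> \<longleftrightarrow>
     compact_space (quotient_topology (Metric_space.mtopology M d) (isom_orbit M d \<Gamma>))"

section \<open>The space of geodesic lines\<close>

text \<open>The topology of uniform convergence on compact subsets of the real line.\<close>

definition geod_topology :: "'a set \<Rightarrow> ('a \<Rightarrow> 'a \<Rightarrow> real) \<Rightarrow> (real \<Rightarrow> 'a) topology" where
  "geod_topology M d =
     topology (\<lambda>U. U \<subseteq> geodesic_lines M d \<and>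
       (\<forall>c\<in>U. \<exists>K \<epsilon>. compact K \<and> 0 < \<epsilon> \<and>
          {c' \<in> geodesic_lines M d. \<forall>t\<in>K. d (c t) (c' t) < \<epsilon>} \<subseteq> U))"

lemma openin_geod_topology:
  "openin (geod_topology M d) U \<longleftrightarrow>
     U \<subseteq> geodesic_lines M d \<and>
     (\<forall>c\<in>U. \<exists>K \<epsilon>. compact K \<and> 0 < \<epsilon> \<and>
        {c' \<in> geodesic_lines M d. \<forall>t\<in>K. d (c t) (c' t) < \<epsilon>} \<subseteq> U)" (is "_ \<longleftrightarrow> ?open U")
proof -
  have "istopology ?open"
  proof (unfold istopology_def, intro conjI allI impI)
    fix S T assume S: "?open S" and T: "?open T"
    then show "S \<inter> T \<subseteq> geodesic_lines M d" by blast
    show "\<forall>c\<in>S \<inter> T. \<exists>K \<epsilon>. compact K \<and> 0 < \<epsilon> \<and>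
        {c' \<in> geodesic_lines M d. \<forall>t\<in>K. d (c t) (c' t) < \<epsilon>} \<subseteq> S \<inter> T"
    proof
      fix c assume c: "c \<in> S \<inter> T"
      obtain K \<epsilon> where 1: "compact K" "0 < \<epsilon>"
          "{c' \<in> geodesic_lines M d. \<forall>t\<in>K. d (c t) (c' t) < \<epsilon>} \<subseteq> S"
        using S c by blast
      obtain L \<eta> where 2: "compact L" "0 < \<eta>"
          "{c' \<in> geodesic_lines M d. \<forall>t\<in>L. d (c t) (c' t) < \<eta>} \<subseteq> T"
        using T c by blast
      show "\<exists>K \<epsilon>. compact K \<and> 0 < \<epsilon> \<and>
          {c' \<in> geodesic_lines M d. \<forall>t\<in>K. d (c t) (c' t) < \<epsilon>} \<subseteq> S \<inter> T"
        using 1 2 by (intro exI[of _ "K \<union> L"] exI[of _ "min \<epsilon> \<eta>"]) (auto simp: compact_Un)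
    qed
  next
    fix \<K> assume "\<forall>S\<in>\<K>. ?open S"
    then show "\<Union>\<K> \<subseteq> geodesic_lines M d"
      and "\<forall>c\<in>\<Union>\<K>. \<exists>K \<epsilon>. compact K \<and> 0 < \<epsilon> \<and>
        {c' \<in> geodesic_lines M d. \<forall>t\<in>K. d (c t) (c' t) < \<epsilon>} \<subseteq> \<Union>\<K>"
      by (blast, meson Union_upper UnionE order_trans)
  qed
  then show ?thesis by (simp add: geod_topology_def)
qed

lemma topspace_geod_topology: "topspace (geod_topology M d) = geodesic_lines M d"
proof
  show "topspace (geod_topology M d) \<subseteq> geodesic_lines M d"
    by (auto simp: topspace_def openin_geod_topology)
  have "openin (geod_topology M d) (geodesic_lines M d)"
    unfolding openin_geod_topology by (blast intro: compact_empty zero_less_one)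
  then show "geodesic_lines M d \<subseteq> topspace (geod_topology M d)" by (rule openin_subset)
qed

definition geod_flow :: "real \<Rightarrow> (real \<Rightarrow> 'a) \<Rightarrow> real \<Rightarrow> 'a" where
  "geod_flow t c = (\<lambda>s. c (s + t))"

definition geod_quotient ::
    "'a set \<Rightarrow> ('a \<Rightarrow> 'a \<Rightarrow> real) \<Rightarrow> ('a \<Rightarrow> 'a) set \<Rightarrow> (real \<Rightarrow> 'a) set topology" where
  "geod_quotient M d \<Gamma> =
     quotient_topology (geod_topology M d) (orbit (isom_subgroup M d \<Gamma>) (\<lambda>g c. g \<circ> c))"

text \<open>
  The flow commutes with the action, hence maps the orbit of \<open>c\<close> onto the orbit of
  \<open>geod_flow t c\<close>: the induced flow is given by taking images of orbits.
\<close>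

definition geod_quotient_flow :: "real \<Rightarrow> (real \<Rightarrow> 'a) set \<Rightarrow> (real \<Rightarrow> 'a) set" where
  "geod_quotient_flow t = image (geod_flow t)"

lemma geod_quotient_flow_orbit:
  "geod_quotient_flow t (orbit G (\<lambda>g c. g \<circ> c) c) = orbit G (\<lambda>g c. g \<circ> c) (geod_flow t c)"
  by (auto simp: geod_quotient_flow_def geod_flow_def orbit_def fun_eq_iff image_iff)

section \<open>Topological entropy\<close>

fun log_enat :: "enat \<Rightarrow> ereal" where
  "log_enat (enat n) = (if n = 0 then - \<infinity> else ereal (ln (real n)))"
| "log_enat \<infinity> = \<infinity>"

definition dynamical_metric ::
    "('a \<Rightarrow> 'a \<Rightarrow> real) \<Rightarrow> ('a \<Rightarrow> 'a) \<Rightarrow> nat \<Rightarrow> 'a \<Rightarrow> 'a \<Rightarrow> real" where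
  "dynamical_metric \<rho> T n y y' = Max ((\<lambda>i. \<rho> ((T ^^ i) y) ((T ^^ i) y')) ` {..<n})"

text \<open>
  Meaningful only for metrizable \<open>Y\<close> and continuous \<open>T\<close>: without a compatible metric the
  infimum would be over the empty set.
\<close>

definition topological_entropy :: "'a topology \<Rightarrow> ('a \<Rightarrow> 'a) \<Rightarrow> ereal" where
  "topological_entropy Y T =
     (INF \<rho>\<in>{\<rho>. Metric_space (topspace Y) \<rho> \<and> Metric_space.mtopology (topspace Y) \<rho> = Y}.
        SUP K\<in>{K. compactin Y K}.
          Lim (at_right 0) (\<lambda>r::real. limsup (\<lambda>n.
            ereal (1 / real n) *
              log_enat (covering_number (topspace Y) (dynamical_metric \<rho> T n) K r))))"

end

theory Submission
  imports Defs
begin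

text \<open>
  The space is the Cayley tree of the free group of rank two times \<open>[0, 1]\<close> with the maximum metric,
  and the group acts on the tree factor only. A geodesic line of the tree together with any
  1-Lipschitz function to \<open>[0, 1]\<close> is a geodesic line of the product. Hence, over the axis of a
  generator, one can choose freely on every interval \<open>[k, k + 1]\<close> one of \<open>N\<close> functions
  vanishing at the endpoints, which embeds the full shift on \<open>N\<close> symbols in the quotient flow. So the
  topological entropy is at least \<open>ln N\<close> for every \<open>N\<close>, whereas the critical exponent only sees
  the tree and is at most \<open>ln 4\<close>. Lines that differ on a single interval violate convexity.
\<close>

section \<open>Entropy and full shifts\<close>

text \<open>The entropy is an infimum over all metrics inducing the topology, so a lower bound may
  rely on no particular metric. A compact shift is used because its compactness yields a separation
  constant for each such metric. The separation must also survive the passage to group orbits. Since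
  the group fixes the interval coordinate, that coordinate of a line, as a function of time, is an
  invariant of its orbit, and a symbol can be read off at the midpoint of its unit interval.
  Advancing a line by one unit translates it by the generator and shifts the symbols, so modulo the
  group only the shift is left. The interval has diameter 1, so the maximum metric exceeds the
  distance in the tree by at most 1; hyperbolicity thus comes from the tree. Metrizability of the
  quotient is proved separately: without a compatible metric the infimum would run over the empty
  set and be infinite, which would make the strict inequality hollow.\<close>

lemma log_enat_mono: "a \<le> b \<Longrightarrow> log_enat a \<le> log_enat b"
  by (cases a; cases b) (auto simp: enat_ord_simps)

lemma covering_number_ge:
  assumes "\<And>C. finite C \<Longrightarrow> C \<subseteq> M \<Longrightarrow> S \<subseteq> (\<Union>c\<in>C. Metric_space.mball M d c r) \<Longrightarrow> n \<le> card C"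
  shows "enat n \<le> covering_number M d S r"
  unfolding covering_number_def using assms by (intro Inf_greatest) auto

lemma covering_number_le:
  assumes "finite C" "C \<subseteq> M" "S \<subseteq> (\<Union>c\<in>C. Metric_space.mball M d c r)"
  shows "covering_number M d S r \<le> enat (card C)"
  unfolding covering_number_def using assms by (intro Inf_lower) blast

lemma covering_number_antimono:
  assumes "Metric_space M d" "r \<le> s"
  shows "covering_number M d S s \<le> covering_number M d S r"
  unfolding covering_number_def
proof (intro Inf_superset_mono subsetI, clarify)
  fix C assume C: "finite C" "C \<subseteq> M" "S \<subseteq> (\<Union>c\<in>C. Metric_space.mball M d c r)"
  have "(\<Union>c\<in>C. Metric_space.mball M d c r) \<subseteq> (\<Union>c\<in>C. Metric_space.mball M d c s)"
    using Metric_space.mball_subset_concentric[OF assms] by blast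
  with C show "\<exists>C'. enat (card C) = enat (card C') \<and> finite C' \<and> C' \<subseteq> M \<and>
      S \<subseteq> (\<Union>c\<in>C'. Metric_space.mball M d c s)"
    by (intro exI[of _ C]) auto
qed

text \<open>\<open>Lim\<close> is a definite description, so the limit over radii in the entropy
  carries no information until it is known to exist. Monotonicity in the radius gives existence and
  identifies the limit with a supremum, which any single radius bounds from below.\<close>

lemma tendsto_at_right_antimono:
  fixes f :: "real \<Rightarrow> 'a :: {complete_linorder, linorder_topology}"
  assumes "\<And>x y. a < x \<Longrightarrow> x \<le> y \<Longrightarrow> f y \<le> f x"
  shows "(f \<longlongrightarrow> (SUP x\<in>{a<..}. f x)) (at_right a)"
proof (rule order_tendstoI)
  fix l assume "l < (SUP x\<in>{a<..}. f x)"
  then obtain x where x: "a < x" "l < f x" by (auto simp: less_SUP_iff)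
  show "\<forall>\<^sub>F y in at_right a. l < f y"
    using eventually_at_right_real[OF x(1)]
  proof eventually_elim
    case (elim y)
    then show ?case using assms[of y x] x by auto
  qed
next
  fix u assume u: "(SUP x\<in>{a<..}. f x) < u"
  show "\<forall>\<^sub>F y in at_right a. f y < u"
    using eventually_at_right_less[of a]
  proof eventually_elim
    case (elim y)
    then have "f y \<le> (SUP x\<in>{a<..}. f x)" by (intro SUP_upper) auto
    with u show ?case by simp
  qed
qed

lemma funpow_in_carrier: "T \<in> Y \<rightarrow> Y \<Longrightarrow> y \<in> Y \<Longrightarrow> (T ^^ i) y \<in> Y"
  by (induction i) auto

text \<open>The index 0 alone gives nonnegativity and separates points; it is available only for
  \<open>n > 0\<close>, since \<open>Max\<close> of the empty set is unspecified.\<close>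

lemma Metric_space_dynamical_metric:
  assumes "Metric_space Y \<rho>" "T \<in> Y \<rightarrow> Y" "n > 0"
  shows "Metric_space Y (dynamical_metric \<rho> T n)"
proof -
  interpret Metric_space Y \<rho> by fact
  have [simp]: "{..<n} \<noteq> {}" using assms(3) by (auto simp: lessThan_empty_iff)
  have le: "\<rho> ((T ^^ i) x) ((T ^^ i) y) \<le> dynamical_metric \<rho> T n x y" if "i < n" for i x y
    unfolding dynamical_metric_def using that by (intro Max_ge) auto
  have nn: "0 \<le> dynamical_metric \<rho> T n x y" for x y
    using order_trans[OF nonneg le[of 0 x y]] assms(3) by simp
  show ?thesis
  proof
    show "0 \<le> dynamical_metric \<rho> T n x y" for x y by (rule nn)
    show "dynamical_metric \<rho> T n x y = dynamical_metric \<rho> T n y x" for x y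
      unfolding dynamical_metric_def by (simp add: commute)
    show "dynamical_metric \<rho> T n x y = 0 \<longleftrightarrow> x = y" if "x \<in> Y" "y \<in> Y" for x y
    proof
      assume "dynamical_metric \<rho> T n x y = 0"
      then have "\<rho> x y \<le> 0" using le[of 0 x y] assms(3) by simp
      then show "x = y" using that nonneg[of x y] zero[of x y] by linarith
    next
      assume "x = y"
      then show "dynamical_metric \<rho> T n x y = 0"
        unfolding dynamical_metric_def using that funpow_in_carrier[OF assms(2)]
        using assms(3) by (auto intro!: Max_eqI simp: image_iff)
    qed
    show "dynamical_metric \<rho> T n x z \<le> dynamical_metric \<rho> T n x y + dynamical_metric \<rho> T n y z"
      if "x \<in> Y" "y \<in> Y" "z \<in> Y" for x y z
    proof -
      have "\<rho> ((T ^^ i) x) ((T ^^ i) z) \<le> dynamical_metric \<rho> T n x y + dynamical_metric \<rho> T n y z"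
        if "i < n" for i
        using triangle[of "(T ^^ i) x" "(T ^^ i) y" "(T ^^ i) z"]
          funpow_in_carrier[OF assms(2)] le[OF that, of x y] le[OF that, of y z]
          \<open>x \<in> Y\<close> \<open>y \<in> Y\<close> \<open>z \<in> Y\<close>
        by fastforce
      then show ?thesis
        unfolding dynamical_metric_def[of \<rho> T n x z] by (subst Max_le_iff) auto
    qed
  qed
qed

abbreviation full_shift :: "nat \<Rightarrow> (int \<Rightarrow> nat) topology" where
  "full_shift N \<equiv> product_topology (\<lambda>_. discrete_topology {..<N}) UNIV"

lemma openin_full_shift_coordinate:
  "openin (full_shift N) {\<omega> \<in> topspace (full_shift N). P (\<omega> k)}"
proof -
  have "{\<omega> \<in> topspace (full_shift N). P (\<omega> k)} =
      {\<omega> \<in> topspace (full_shift N). \<omega> k \<in> {a. a < N \<and> P a}}"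
    by (auto simp: PiE_iff)
  moreover have "openin (full_shift N) {\<omega> \<in> topspace (full_shift N). \<omega> k \<in> {a. a < N \<and> P a}}"
    by (rule openin_continuous_map_preimage[OF continuous_map_product_projection]) auto
  ultimately show ?thesis by simp
qed

text \<open>Compactness of the shift makes the separation uniform, whatever the compatible metric.\<close>

lemma full_shift_uniform_separation:
  assumes cont: "continuous_map (full_shift N) Y \<Psi>"
    and sep: "\<And>\<omega> \<omega>'. \<lbrakk>range \<omega> \<subseteq> {..<N}; range \<omega>' \<subseteq> {..<N}; \<omega> 0 \<noteq> \<omega>' 0\<rbrakk> \<Longrightarrow> \<Psi> \<omega> \<noteq> \<Psi> \<omega>'"
    and met: "Metric_space (topspace Y) \<rho>" "Metric_space.mtopology (topspace Y) \<rho> = Y"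
  obtains e where "e > 0" "\<And>\<omega> \<omega>'. \<lbrakk>range \<omega> \<subseteq> {..<N}; range \<omega>' \<subseteq> {..<N}; \<omega> 0 \<noteq> \<omega>' 0\<rbrakk> \<Longrightarrow> e \<le> \<rho> (\<Psi> \<omega>) (\<Psi> \<omega>')"
proof -
  interpret R: Metric_space "topspace Y" \<rho> by fact
  let ?S = "full_shift N"
  let ?P = "prod_topology ?S ?S"
  have top: "\<omega> \<in> topspace ?S \<longleftrightarrow> range \<omega> \<subseteq> {..<N}" for \<omega>
    by (auto simp: PiE_iff)
  define F where "F p = \<rho> (\<Psi> (fst p)) (\<Psi> (snd p))" for p
  have "continuous_map ?P (mtopology_of R.Self) (\<lambda>p. \<Psi> (fst p))"
    "continuous_map ?P (mtopology_of R.Self) (\<lambda>p. \<Psi> (snd p))"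
    using continuous_map_compose[OF continuous_map_fst cont]
      continuous_map_compose[OF continuous_map_snd cont] met(2)
    by (simp_all add: comp_def R.Self_def)
  then have "continuous_map ?P euclidean (\<lambda>p. mdist R.Self (\<Psi> (fst p)) (\<Psi> (snd p)))"
    by (rule continuous_map_mdist)
  then have contF: "continuous_map ?P euclideanreal F"
    by (simp add: F_def[abs_def])
  define A where "A = {p \<in> topspace ?P. fst p 0 \<noteq> snd p 0}"
  \<comment> \<open>Agreement at coordinate 0 is a union of open rectangles, one per letter. Its
    complement \<open>A\<close> is therefore closed, hence compact, and \<open>F\<close> attains a
    minimum there.\<close>
  have "openin ?P {p \<in> topspace ?P. fst p 0 = snd p 0}"
  proof -
    have "{p \<in> topspace ?P. fst p 0 = snd p 0} =
        (\<Union>a. {\<omega> \<in> topspace ?S. \<omega> 0 = a} \<times> {\<omega> \<in> topspace ?S. \<omega> 0 = a})"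
      by auto
    moreover have "openin ?P \<dots>"
    proof (intro openin_Union, clarify)
      fix a :: nat
      have "openin ?S {\<omega> \<in> topspace ?S. \<omega> 0 = a}"
        by (rule openin_full_shift_coordinate[where P = "\<lambda>x. x = a"])
      then show "openin ?P ({\<omega> \<in> topspace ?S. \<omega> 0 = a} \<times> {\<omega> \<in> topspace ?S. \<omega> 0 = a})"
        unfolding openin_prod_Times_iff by blast
    qed
    ultimately show ?thesis by simp
  qed
  then have "closedin ?P A"
    unfolding A_def closedin_def by (auto elim!: back_subst[of "openin ?P"])
  moreover have "compact_space ?S"
    by (simp add: compact_space_product_topology compact_space_discrete_topology)
  then have "compact_space ?P" by (simp add: compact_space_prod_topology)
  ultimately have "compactin ?P A" by (intro closedin_compact_space)
  then have comp: "compact (F ` A)"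
    using image_compactin[OF _ contF] by simp
  show ?thesis
  proof (cases "A = {}")
    \<comment> \<open>This happens exactly when \<open>N \<le> 1\<close>; every positive constant
      then works.\<close>
    case True
    have "\<omega> 0 = \<omega>' 0" if "range \<omega> \<subseteq> {..<N}" "range \<omega>' \<subseteq> {..<N}" for \<omega> \<omega>' :: "int \<Rightarrow> nat"
    proof (rule ccontr)
      assume "\<omega> 0 \<noteq> \<omega>' 0"
      with that have "(\<omega>, \<omega>') \<in> A" unfolding A_def by (simp add: top del: topspace_product_topology)
      with True show False by simp
    qed
    then show ?thesis using that[of 1] by auto
  next
    case False
    then obtain p where p: "p \<in> A" "\<And>q. q \<in> A \<Longrightarrow> F p \<le> F q"
      using compact_attains_inf[OF comp] by auto
    have fs: "range (fst p) \<subseteq> {..<N}" "range (snd p) \<subseteq> {..<N}" "fst p 0 \<noteq> snd p 0"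
      using p(1) unfolding A_def by (simp_all add: top mem_Times_iff del: topspace_product_topology)
    then have "\<Psi> (fst p) \<in> topspace Y" "\<Psi> (snd p) \<in> topspace Y"
      using continuous_map_image_subset_topspace[OF cont] unfolding top[symmetric] by blast+
    then have "F p > 0"
      unfolding F_def using sep[OF fs] by (intro R.mdist_pos_less)
    moreover have "F p \<le> \<rho> (\<Psi> \<omega>) (\<Psi> \<omega>')" if "range \<omega> \<subseteq> {..<N}" "range \<omega>' \<subseteq> {..<N}" "\<omega> 0 \<noteq> \<omega>' 0" for \<omega> \<omega>'
      using p(2)[of "(\<omega>, \<omega>')"] that unfolding A_def F_def
      by (simp add: top del: topspace_product_topology)
    ultimately show ?thesis using that by blast
  qed
qed

text \<open>Equivariance moves coordinate \<open>i\<close> to coordinate 0, so two words that differ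
  somewhere in a window of length \<open>n\<close> have images at least \<open>e\<close> apart in
  the \<open>n\<close>-th dynamical metric. A ball of radius \<open>e / 2\<close> then contains the
  image of at most one of the \<open>N ^ n\<close> windows. Separation by coordinate 0 is thus all
  that is asked of \<open>\<Psi>\<close>.\<close>

theorem topological_entropy_ge_full_shift:
  assumes cont: "continuous_map (full_shift N) Y \<Psi>"
    and T: "T \<in> topspace Y \<rightarrow> topspace Y"
    and shift: "\<And>\<omega>. range \<omega> \<subseteq> {..<N} \<Longrightarrow> T (\<Psi> \<omega>) = \<Psi> (\<lambda>k. \<omega> (k + 1))"
    and sep: "\<And>\<omega> \<omega>'. \<lbrakk>range \<omega> \<subseteq> {..<N}; range \<omega>' \<subseteq> {..<N}; \<omega> 0 \<noteq> \<omega>' 0\<rbrakk> \<Longrightarrow> \<Psi> \<omega> \<noteq> \<Psi> \<omega>'"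
    and N: "N > 0"
  shows "topological_entropy Y T \<ge> ereal (ln (real N))"
  unfolding topological_entropy_def
proof (rule INF_greatest, clarify)
  fix \<rho> assume met: "Metric_space (topspace Y) \<rho>" "Metric_space.mtopology (topspace Y) \<rho> = Y"
  interpret R: Metric_space "topspace Y" \<rho> by fact
  let ?S = "full_shift N"
  have top: "\<omega> \<in> topspace ?S \<longleftrightarrow> range \<omega> \<subseteq> {..<N}" for \<omega>
    by (auto simp: PiE_iff)
  obtain e where e: "e > 0" "\<And>\<omega> \<omega>'. \<lbrakk>range \<omega> \<subseteq> {..<N}; range \<omega>' \<subseteq> {..<N}; \<omega> 0 \<noteq> \<omega>' 0\<rbrakk> \<Longrightarrow> e \<le> \<rho> (\<Psi> \<omega>) (\<Psi> \<omega>')"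
    using full_shift_uniform_separation[OF cont sep met] by blast
  have iter: "(T ^^ i) (\<Psi> \<omega>) = \<Psi> (\<lambda>k. \<omega> (k + int i))" if "range \<omega> \<subseteq> {..<N}" for \<omega> i
  proof (induction i)
    case (Suc i)
    have "T (\<Psi> (\<lambda>k. \<omega> (k + int i))) = \<Psi> (\<lambda>k. \<omega> (k + 1 + int i))"
      using that by (intro shift) auto
    with Suc show ?case by (simp add: algebra_simps)
  qed simp
  define K where "K = \<Psi> ` topspace ?S"
  have "compact_space ?S"
    by (simp add: compact_space_product_topology compact_space_discrete_topology)
  then have K: "compactin Y K"
    unfolding K_def compact_space_def by (rule image_compactin) (rule cont)
  define f where "f r n = ereal (1 / real n) *
      log_enat (covering_number (topspace Y) (dynamical_metric \<rho> T n) K r)" for r n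
  have dyn: "Metric_space (topspace Y) (dynamical_metric \<rho> T n)" if "n > 0" for n
    using Metric_space_dynamical_metric[OF met(1) T that] .
  have anti: "limsup (f s) \<le> limsup (f r)" if "r \<le> s" for r s
  proof (rule Limsup_mono)
    show "\<forall>\<^sub>F n in sequentially. f s n \<le> f r n"
      using eventually_gt_at_top[of 0]
    proof eventually_elim
      case (elim n)
      then show ?case unfolding f_def
        by (intro ereal_mult_left_mono log_enat_mono covering_number_antimono dyn that) auto
    qed
  qed
  have big: "ereal (ln (real N)) \<le> f (e / 2) n" if n: "n > 0" for n
  proof -
    interpret D: Metric_space "topspace Y" "dynamical_metric \<rho> T n" by (rule dyn[OF n])
    have "enat (N ^ n) \<le> covering_number (topspace Y) (dynamical_metric \<rho> T n) K (e / 2)"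
    proof (rule covering_number_ge)
      fix C assume C: "finite C" "K \<subseteq> (\<Union>c\<in>C. D.mball c (e / 2))"
      \<comment> \<open>Outside the window the word is padded with the letter 0, which belongs to
        the alphabet because \<open>N > 0\<close>.\<close>
      define ext where "ext u k = (if 0 \<le> k \<and> k < int n then u (nat k) else 0)"
        for u :: "nat \<Rightarrow> nat" and k :: int
      define W where "W = {..<n} \<rightarrow>\<^sub>E {..<N}"
      have ext: "range (ext u) \<subseteq> {..<N}" if "u \<in> W" for u
        using that N unfolding W_def ext_def by (auto simp: PiE_iff)
      have "\<exists>c. c \<in> C \<and> \<Psi> (ext u) \<in> D.mball c (e / 2)" if "u \<in> W" for u
        using C(2) ext[OF that] top unfolding K_def by blast
      then obtain h where h: "\<And>u. u \<in> W \<Longrightarrow> h u \<in> C"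
          "\<And>u. u \<in> W \<Longrightarrow> \<Psi> (ext u) \<in> D.mball (h u) (e / 2)"
        by metis
      have "inj_on h W"
      proof (rule inj_onI, rule ccontr)
        fix u v assume uv: "u \<in> W" "v \<in> W" "h u = h v" "u \<noteq> v"
        then obtain i where i: "i < n" "u i \<noteq> v i"
          unfolding W_def by (metis PiE_ext lessThan_iff)
        have "e \<le> \<rho> (\<Psi> (\<lambda>k. ext u (k + int i))) (\<Psi> (\<lambda>k. ext v (k + int i)))"
          using ext[OF uv(1)] ext[OF uv(2)] i by (intro e(2)) (auto simp: ext_def)
        also have "\<dots> = \<rho> ((T ^^ i) (\<Psi> (ext u))) ((T ^^ i) (\<Psi> (ext v)))"
          using ext[OF uv(1)] ext[OF uv(2)] by (simp add: iter)
        also have "\<dots> \<le> dynamical_metric \<rho> T n (\<Psi> (ext u)) (\<Psi> (ext v))"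
          unfolding dynamical_metric_def using i by (intro Max_ge) auto
        also have "\<dots> < e"
          using h(2)[OF uv(1)] h(2)[OF uv(2)] uv(3)
            D.triangle''[of "\<Psi> (ext u)" "h u" "\<Psi> (ext v)"] by auto
        finally show False by simp
      qed
      then have "card W \<le> card C"
        using h(1) C(1) by (intro card_inj_on_le[of h]) auto
      then show "N ^ n \<le> card C" by (simp add: W_def card_PiE)
    qed
    then have "log_enat (enat (N ^ n)) \<le>
        log_enat (covering_number (topspace Y) (dynamical_metric \<rho> T n) K (e / 2))"
      by (rule log_enat_mono)
    then have "ereal (1 / real n) * log_enat (enat (N ^ n)) \<le> f (e / 2) n"
      unfolding f_def by (intro ereal_mult_left_mono) auto
    moreover have "ereal (1 / real n) * log_enat (enat (N ^ n)) = ereal (ln (real N))"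
      using n N by (simp add: ln_realpow)
    ultimately show ?thesis by simp
  qed
  have "ereal (ln (real N)) = limsup (\<lambda>n. ereal (ln (real N)))" by (simp add: Limsup_const)
  also have "\<dots> \<le> limsup (f (e / 2))"
    by (intro Limsup_mono eventually_mono[OF eventually_gt_at_top[of 0]] big)
  also have "\<dots> \<le> (SUP r\<in>{0<..}. limsup (f r))" using e(1) by (intro SUP_upper) auto
  also have "\<dots> = Lim (at_right 0) (\<lambda>r. limsup (f r))"
    by (rule tendsto_Lim[symmetric], simp, rule tendsto_at_right_antimono) (rule anti)
  also have "\<dots> \<le> (SUP K\<in>{K. compactin Y K}. Lim (at_right 0) (\<lambda>r::real. limsup (\<lambda>n.
            ereal (1 / real n) *
              log_enat (covering_number (topspace Y) (dynamical_metric \<rho> T n) K r))))"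
    unfolding f_def[abs_def] using K by (intro SUP_upper) simp
  finally show "ereal (ln (real N)) \<le> (SUP K\<in>{K. compactin Y K}. Lim (at_right 0) (\<lambda>r::real. limsup (\<lambda>n.
            ereal (1 / real n) *
              log_enat (covering_number (topspace Y) (dynamical_metric \<rho> T n) K r))))" .
qed

section \<open>Quotients by isometric actions\<close>

text \<open>The metric is the infimum of the distances between two fibres. The hypothesis
  \<open>lift\<close> abstracts an isometric action whose orbits are the fibres: from every point of
  one fibre the other looks the same, which yields the triangle inequality without chains of
  intermediate points. The hypothesis \<open>sep\<close> gives positivity.\<close>

lemma metrizable_quotient_topology:
  assumes met: "Metric_space Y \<rho>"
    and lift: "\<And>y y' z. \<lbrakk>y \<in> Y; y' \<in> Y; z \<in> Y; q y = q y'\<rbrakk> \<Longrightarrow> \<exists>z'\<in>Y. q z' = q z \<and> \<rho> y' z' = \<rho> y z"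
    and sep: "\<And>y z. \<lbrakk>y \<in> Y; z \<in> Y; q y \<noteq> q z\<rbrakk> \<Longrightarrow> \<exists>e>0. \<forall>z'\<in>Y. q z' = q z \<longrightarrow> e \<le> \<rho> y z'"
  shows "metrizable_space (quotient_topology (Metric_space.mtopology Y \<rho>) q)"
proof -
  interpret Metric_space Y \<rho> by fact
  define S where "S A B = {\<rho> y z | y z. y \<in> Y \<and> z \<in> Y \<and> q y = A \<and> q z = B}" for A B
  \<comment> \<open>The default 0 keeps \<open>D\<close> nonnegative and symmetric off the image,
    where \<open>Metric_space\<close> still demands both.\<close>
  define D where "D A B = (if A \<in> q ` Y \<and> B \<in> q ` Y then Inf (S A B) else 0)" for A B
  have bdd: "bdd_below (S A B)" for A B
    unfolding S_def by (rule bdd_belowI[of _ 0]) auto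
  have D_le: "D (q y) (q z) \<le> \<rho> y z" if "y \<in> Y" "z \<in> Y" for y z
    unfolding D_def using that by (auto simp: S_def intro!: cInf_lower bdd[unfolded S_def])
  \<comment> \<open>The infimum is approached from any prescribed point of the first fibre. The
    triangle inequality uses this twice, the second time starting at the point reached by the
    first.\<close>
  have near: "\<exists>z'\<in>Y. q z' = q z \<and> \<rho> y z' < r" if "y \<in> Y" "z \<in> Y" "D (q y) (q z) < r" for y z r
  proof -
    have "S (q y) (q z) \<noteq> {}" using that by (auto simp: S_def)
    moreover have "Inf (S (q y) (q z)) < r" using that by (simp add: D_def)
    ultimately obtain v where "v \<in> S (q y) (q z)" "v < r" by (meson cInf_lessD)
    then obtain y1 z1 where 1: "y1 \<in> Y" "z1 \<in> Y" "q y1 = q y" "q z1 = q z" "\<rho> y1 z1 < r"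
      by (auto simp: S_def)
    then show ?thesis using lift[of y1 y z1] that by metis
  qed
  have Dmet: "Metric_space (q ` Y) D"
  proof
    show "0 \<le> D A B" for A B
    proof (cases "A \<in> q ` Y \<and> B \<in> q ` Y")
      case True
      then have "S A B \<noteq> {}" by (auto simp: S_def)
      then have "0 \<le> Inf (S A B)" by (rule cInf_greatest) (auto simp: S_def)
      then show ?thesis by (simp add: D_def)
    qed (auto simp: D_def)
    have "S A B = S B A" for A B
      unfolding S_def by (auto simp: commute) (metis commute)+
    then show "D A B = D B A" for A B by (simp add: D_def)
    show "D A B = 0 \<longleftrightarrow> A = B" if AB: "A \<in> q ` Y" "B \<in> q ` Y" for A B
    proof
      obtain y z where y: "y \<in> Y" "A = q y" and z: "z \<in> Y" "B = q z" using AB by auto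
      show "A = B" if "D A B = 0"
      proof (rule ccontr)
        assume "A \<noteq> B"
        then obtain e where "e > 0" "\<forall>z'\<in>Y. q z' = q z \<longrightarrow> e \<le> \<rho> y z'"
          using sep[OF y(1) z(1)] y z by auto
        then show False using near[OF y(1) z(1), of e] that y z by force
      qed
      show "D A B = 0" if "A = B"
        using D_le[OF y(1) y(1)] \<open>0 \<le> D A B\<close> y that by simp
    qed
    show "D A C \<le> D A B + D B C" if ABC: "A \<in> q ` Y" "B \<in> q ` Y" "C \<in> q ` Y" for A B C
    proof (rule field_le_epsilon)
      fix e :: real assume e: "e > 0"
      obtain x y z where x: "x \<in> Y" "A = q x" and y: "y \<in> Y" "B = q y" and z: "z \<in> Y" "C = q z"
        using ABC by blast
      obtain y' where y': "y' \<in> Y" "q y' = q y" "\<rho> x y' < D A B + e / 2"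
        using near[OF x(1) y(1), of "D A B + e / 2"] e x y by auto
      obtain z' where z': "z' \<in> Y" "q z' = q z" "\<rho> y' z' < D B C + e / 2"
        using near[OF y'(1) z(1), of "D B C + e / 2"] e y' y z by auto
      have "D A C \<le> \<rho> x z'" using D_le[OF x(1) z'(1)] x z z' by simp
      also have "\<dots> \<le> \<rho> x y' + \<rho> y' z'" using x y' z' by (intro triangle)
      finally show "D A C \<le> D A B + D B C + e" using y' z' by simp
    qed
  qed
  interpret Q: Metric_space "q ` Y" D by (rule Dmet)
  have "quotient_topology mtopology q = Q.mtopology"
  proof (rule topology_eq[THEN iffD2], intro allI iffI)
    fix U assume "openin (quotient_topology mtopology q) U"
    then have U: "U \<subseteq> q ` Y" "openin mtopology {y \<in> Y. q y \<in> U}"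
      by (auto simp: openin_quotient_topology)
    show "openin Q.mtopology U"
      unfolding Q.openin_mtopology
    proof (intro conjI U allI impI)
      fix A assume "A \<in> U"
      then obtain y where y: "y \<in> Y" "A = q y" using U by auto
      then obtain r where r: "r > 0" "mball y r \<subseteq> {y \<in> Y. q y \<in> U}"
        using U(2) \<open>A \<in> U\<close> unfolding openin_mtopology by auto
      have "Q.mball A r \<subseteq> U"
      proof
        fix B assume "B \<in> Q.mball A r"
        then obtain z where "z \<in> Y" "B = q z" "D A B < r" by auto
        then obtain z' where "z' \<in> Y" "q z' = B" "\<rho> y z' < r" using near[of y z r] y by auto
        then show "B \<in> U" using r y by (auto simp: subset_iff)
      qed
      then show "\<exists>r>0. Q.mball A r \<subseteq> U" using r(1) by blast
    qed
  next
    fix U assume U: "openin Q.mtopology U"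
    have "openin mtopology {y \<in> Y. q y \<in> U}"
      unfolding openin_mtopology
    proof (intro conjI allI impI)
      fix y assume y: "y \<in> {y \<in> Y. q y \<in> U}"
      then obtain r where r: "r > 0" "Q.mball (q y) r \<subseteq> U"
        using U unfolding Q.openin_mtopology by auto
      have "mball y r \<subseteq> {y \<in> Y. q y \<in> U}"
      proof
        fix z assume "z \<in> mball y r"
        then have "q z \<in> Q.mball (q y) r" using D_le[of y z] by auto
        then show "z \<in> {y \<in> Y. q y \<in> U}" using r \<open>z \<in> mball y r\<close> by auto
      qed
      then show "\<exists>r>0. mball y r \<subseteq> {y \<in> Y. q y \<in> U}" using r(1) by blast
    qed auto
    moreover have "U \<subseteq> q ` Y" using U unfolding Q.openin_mtopology by simp
    ultimately show "openin (quotient_topology mtopology q) U"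
      by (simp add: openin_quotient_topology)
  qed
  then show ?thesis using Q.metrizable_space_mtopology by simp
qed

section \<open>The space of geodesic lines is metrizable\<close>

text \<open>Two lines drift apart at most linearly in time, so the quadratic weight makes the
  supremum finite and its tail uniformly small. The tail estimate is what recovers uniform
  convergence on compact sets.\<close>

definition geod_dist :: "'a set \<Rightarrow> ('a \<Rightarrow> 'a \<Rightarrow> real) \<Rightarrow> (real \<Rightarrow> 'a) \<Rightarrow> (real \<Rightarrow> 'a) \<Rightarrow> real" where
  "geod_dist M d c c' =
     (if c \<in> geodesic_lines M d \<and> c' \<in> geodesic_lines M d
      then SUP t. d (c t) (c' t) / (1 + t\<^sup>2) else 0)"

lemma one_plus_square_pos: "0 < 1 + (t::real)\<^sup>2"
  by (simp add: add_pos_nonneg)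

context Metric_space
begin

abbreviation "lines \<equiv> geodesic_lines M d"
abbreviation "gd \<equiv> geod_dist M d"

lemma lines_in_carrier: "c \<in> lines \<Longrightarrow> c t \<in> M"
  by (auto simp: geodesic_lines_def)

lemma lines_dist: "c \<in> lines \<Longrightarrow> d (c s) (c t) = \<bar>s - t\<bar>"
  by (auto simp: geodesic_lines_def)

lemma dist_lines_le:
  assumes "c \<in> lines" "c' \<in> lines"
  shows "d (c t) (c' t) \<le> d (c 0) (c' 0) + 2 * \<bar>t\<bar>"
  using triangle[of "c t" "c 0" "c' t"] triangle[of "c 0" "c' 0" "c' t"]
    lines_dist[OF assms(1), of t 0] lines_dist[OF assms(2), of 0 t] lines_in_carrier assms
  by force

lemma bdd_above_geod_dist:
  assumes "c \<in> lines" "c' \<in> lines"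
  shows "bdd_above (range (\<lambda>t. d (c t) (c' t) / (1 + t\<^sup>2)))"
proof (rule bdd_aboveI2)
  fix t :: real
  have "0 \<le> (\<bar>t\<bar> - 1)\<^sup>2" by simp
  then have "2 * \<bar>t\<bar> \<le> 1 + t\<^sup>2" by (simp add: power2_eq_square algebra_simps)
  moreover have "0 \<le> d (c 0) (c' 0) * t\<^sup>2" by simp
  ultimately have "d (c t) (c' t) \<le> (d (c 0) (c' 0) + 1) * (1 + t\<^sup>2)"
    using dist_lines_le[OF assms, of t] unfolding ring_distribs by linarith
  then show "d (c t) (c' t) / (1 + t\<^sup>2) \<le> d (c 0) (c' 0) + 1"
    using one_plus_square_pos[of t] by (simp add: divide_le_eq)
qed

lemma geod_dist_upper:
  assumes "c \<in> lines" "c' \<in> lines"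
  shows "d (c t) (c' t) \<le> gd c c' * (1 + t\<^sup>2)"
proof -
  have "d (c t) (c' t) / (1 + t\<^sup>2) \<le> gd c c'"
    using cSUP_upper[OF UNIV_I bdd_above_geod_dist[OF assms], of t] assms by (simp add: geod_dist_def)
  then show ?thesis using one_plus_square_pos[of t] by (simp add: divide_le_eq)
qed

lemma geod_dist_least:
  assumes "c \<in> lines" "c' \<in> lines" "\<And>t. d (c t) (c' t) \<le> b * (1 + t\<^sup>2)"
  shows "gd c c' \<le> b"
proof -
  have "d (c t) (c' t) / (1 + t\<^sup>2) \<le> b" for t
    using assms(3)[of t] one_plus_square_pos[of t] by (simp add: divide_le_eq)
  then show ?thesis using assms(1,2) by (auto simp: geod_dist_def intro: cSUP_least)
qed

lemma Metric_space_geod_dist: "Metric_space lines gd"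
proof
  show "0 \<le> gd c c'" for c c'
  proof (cases "c \<in> lines \<and> c' \<in> lines")
    case True
    then show ?thesis using order_trans[OF nonneg geod_dist_upper[of c c' 0]] by simp
  qed (auto simp: geod_dist_def)
  show "gd c c' = gd c' c" for c c'
    by (simp add: geod_dist_def commute)
  show "gd c c' = 0 \<longleftrightarrow> c = c'" if c: "c \<in> lines" "c' \<in> lines" for c c'
  proof
    assume "gd c c' = 0"
    then have "d (c t) (c' t) = 0" for t using geod_dist_upper[OF c, of t] nonneg[of "c t" "c' t"] by simp
    then show "c = c'" using c by (auto simp: lines_in_carrier)
  next
    assume "c = c'"
    then show "gd c c' = 0" using c lines_in_carrier[OF c(1)] by (simp add: geod_dist_def)
  qed
  show "gd c c'' \<le> gd c c' + gd c' c''" if c: "c \<in> lines" "c' \<in> lines" "c'' \<in> lines" for c c' c''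
  proof (rule geod_dist_least[OF c(1,3)])
    fix t
    show "d (c t) (c'' t) \<le> (gd c c' + gd c' c'') * (1 + t\<^sup>2)"
      using geod_dist_upper[OF c(1,2), of t] geod_dist_upper[OF c(2,3), of t]
        triangle[of "c t" "c' t" "c'' t"] c lines_in_carrier by (simp add: algebra_simps)
  qed
qed

text \<open>On a compact set the weight is bounded, so a small \<open>gd\<close> forces uniform
  closeness there. Conversely, far from 0 the quadratic weight beats the linear drift, so closeness
  on one large interval controls the whole supremum.\<close>

lemma geod_topology_eq_mtopology: "geod_topology M d = Metric_space.mtopology lines gd"
proof -
  interpret L: Metric_space lines gd by (rule Metric_space_geod_dist)
  show ?thesis
  proof (rule topology_eq[THEN iffD2], intro allI iffI)
    fix U assume "openin (geod_topology M d) U"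
    then have U: "U \<subseteq> lines" "\<And>c. c \<in> U \<Longrightarrow> \<exists>K \<epsilon>. compact K \<and> 0 < \<epsilon> \<and>
        {c' \<in> lines. \<forall>t\<in>K. d (c t) (c' t) < \<epsilon>} \<subseteq> U"
      unfolding openin_geod_topology by auto
    show "openin L.mtopology U"
      unfolding L.openin_mtopology
    proof (intro conjI allI impI U)
      fix c assume "c \<in> U"
      then obtain K \<epsilon> where K: "compact K" "0 < \<epsilon>" "{c' \<in> lines. \<forall>t\<in>K. d (c t) (c' t) < \<epsilon>} \<subseteq> U"
        using U(2)[OF \<open>c \<in> U\<close>] by (elim exE conjE) (rule that)
      obtain m where m: "\<And>t. t \<in> K \<Longrightarrow> \<bar>t\<bar> \<le> m"
        using compact_imp_bounded[OF K(1)] by (auto simp: bounded_iff)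
      have "L.mball c (\<epsilon> / (1 + m\<^sup>2)) \<subseteq> U"
      proof (rule order_trans[OF subsetI K(3)])
        fix c' assume "c' \<in> L.mball c (\<epsilon> / (1 + m\<^sup>2))"
        then have c': "c \<in> lines" "c' \<in> lines" "gd c c' * (1 + m\<^sup>2) < \<epsilon>"
          using one_plus_square_pos[of m] by (auto simp: less_divide_eq)
        have "d (c t) (c' t) < \<epsilon>" if "t \<in> K" for t
        proof -
          have "t\<^sup>2 \<le> m\<^sup>2" using m[OF that] by (simp add: abs_le_square_iff[symmetric])
          then have "gd c c' * (1 + t\<^sup>2) \<le> gd c c' * (1 + m\<^sup>2)" by (intro mult_left_mono) auto
          then show ?thesis using geod_dist_upper[OF c'(1,2), of t] c'(3) by simp
        qed
        then show "c' \<in> {c' \<in> lines. \<forall>t\<in>K. d (c t) (c' t) < \<epsilon>}" using c' by simp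
      qed
      moreover have "0 < \<epsilon> / (1 + m\<^sup>2)" using K(2) one_plus_square_pos[of m] by simp
      ultimately show "\<exists>r>0. L.mball c r \<subseteq> U" by blast
    qed
  next
    fix U assume "openin L.mtopology U"
    then have U: "U \<subseteq> lines" "\<And>c. c \<in> U \<Longrightarrow> \<exists>r>0. L.mball c r \<subseteq> U"
      unfolding L.openin_mtopology by auto
    show "openin (geod_topology M d) U"
      unfolding openin_geod_topology
    proof (intro conjI ballI U)
      fix c assume c: "c \<in> U"
      then obtain r where r: "r > 0" "L.mball c r \<subseteq> U" using U by blast
      \<comment> \<open>For \<open>\<bar>t\<bar> > m\<close> the drift is at most
        \<open>1 + 2 * \<bar>t\<bar>\<close>, hence at most \<open>3 * \<bar>t\<bar>\<close> as
        \<open>m \<ge> 1\<close>; the bound \<open>6 / r\<close> makes this at most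
        \<open>r / 2\<close> times the square of \<open>t\<close>. The 1 in the drift comes from
        \<open>\<epsilon> \<le> 1\<close>.\<close>
      define m where "m = max 1 (6 / r)"
      define \<epsilon> where "\<epsilon> = min 1 (r / 2)"
      have m: "m \<ge> 1" "6 \<le> r * m" using r(1) by (auto simp: m_def max_def field_simps)
      have "{c' \<in> lines. \<forall>t\<in>{-m..m}. d (c t) (c' t) < \<epsilon>} \<subseteq> U"
      proof (rule order_trans[OF subsetI r(2)])
        fix c' assume "c' \<in> {c' \<in> lines. \<forall>t\<in>{-m..m}. d (c t) (c' t) < \<epsilon>}"
        then have c': "c \<in> lines" "c' \<in> lines" "\<And>t. \<bar>t\<bar> \<le> m \<Longrightarrow> d (c t) (c' t) < \<epsilon>"
          using c U(1) by (auto simp: abs_le_iff)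
        have "gd c c' \<le> r / 2"
        proof (rule geod_dist_least[OF c'(1,2)])
          fix t
          show "d (c t) (c' t) \<le> r / 2 * (1 + t\<^sup>2)"
          proof (cases "\<bar>t\<bar> \<le> m")
            case True
            have "r / 2 * 1 \<le> r / 2 * (1 + t\<^sup>2)" using r(1) by (intro mult_left_mono) auto
            then show ?thesis using c'(3)[OF True] by (simp add: \<epsilon>_def)
          next
            case False
            have "d (c 0) (c' 0) < 1" using c'(3)[of 0] m by (simp add: \<epsilon>_def)
            then have "d (c t) (c' t) \<le> 3 * \<bar>t\<bar>"
              using dist_lines_le[OF c'(1,2), of t] False m by simp
            also have "\<dots> \<le> r * m / 2 * \<bar>t\<bar>" using m by (intro mult_right_mono) auto
            also have "\<dots> \<le> r / 2 * (\<bar>t\<bar> * \<bar>t\<bar>)"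
              using mult_right_mono[of m "\<bar>t\<bar>" "\<bar>t\<bar>"] False r(1) by simp
            also have "\<dots> \<le> r / 2 * (1 + t\<^sup>2)"
              using r(1) by (intro mult_left_mono) (auto simp: power2_eq_square)
            finally show ?thesis .
          qed
        qed
        then show "c' \<in> L.mball c r" using c' r(1) by simp
      qed
      moreover have "0 < \<epsilon>" using r(1) by (simp add: \<epsilon>_def)
      ultimately show "\<exists>K \<epsilon>. compact K \<and> 0 < \<epsilon> \<and> {c' \<in> lines. \<forall>t\<in>K. d (c t) (c' t) < \<epsilon>} \<subseteq> U"
        by (meson compact_Icc)
    qed
  qed
qed

lemma geod_flow_lines: "c \<in> lines \<Longrightarrow> geod_flow a c \<in> lines"
  by (auto simp: geod_flow_def geodesic_lines_def)

lemma continuous_map_geod_flow: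
  "continuous_map (geod_topology M d) (geod_topology M d) (geod_flow a)"
proof (rule continuous_map[THEN iffD2], intro conjI allI impI)
  show "geod_flow a ` topspace (geod_topology M d) \<subseteq> topspace (geod_topology M d)"
    by (auto simp: topspace_geod_topology geod_flow_lines)
next
  fix U assume "openin (geod_topology M d) U"
  then have U: "U \<subseteq> lines" "\<And>c. c \<in> U \<Longrightarrow> \<exists>K \<epsilon>. compact K \<and> 0 < \<epsilon> \<and>
      {c' \<in> lines. \<forall>t\<in>K. d (c t) (c' t) < \<epsilon>} \<subseteq> U"
    unfolding openin_geod_topology by auto
  show "openin (geod_topology M d) {c \<in> topspace (geod_topology M d). geod_flow a c \<in> U}"
    unfolding openin_geod_topology topspace_geod_topology
  proof (intro conjI ballI)
    fix c assume "c \<in> {c \<in> lines. geod_flow a c \<in> U}"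
    then have "geod_flow a c \<in> U" by simp
    from U(2)[OF this] obtain K \<epsilon> where K: "compact K" "0 < \<epsilon>"
        "{c' \<in> lines. \<forall>t\<in>K. d (geod_flow a c t) (c' t) < \<epsilon>} \<subseteq> U"
      by (elim exE conjE) (rule that)
    have "{c' \<in> lines. \<forall>t\<in>(\<lambda>t. t + a) ` K. d (c t) (c' t) < \<epsilon>} \<subseteq> {c \<in> lines. geod_flow a c \<in> U}"
      using K(3) geod_flow_lines by (auto simp: geod_flow_def subset_iff)
    moreover have "compact ((\<lambda>t. t + a) ` K)"
      using K(1) by (intro compact_continuous_image continuous_intros)
    ultimately show "\<exists>K \<epsilon>. compact K \<and> 0 < \<epsilon> \<and> 
        {c' \<in> lines. \<forall>t\<in>K. d (c t) (c' t) < \<epsilon>} \<subseteq> {c \<in> lines. geod_flow a c \<in> U}"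
      using K(2) by blast
  qed auto
qed

end

section \<open>Discrete groups of isometries\<close>

locale isom_action = Metric_space M d
  for M :: "'a set" and d :: "'a \<Rightarrow> 'a \<Rightarrow> real" +
  fixes \<Gamma> :: "('a \<Rightarrow> 'a) set"
  assumes subgroup: "subgroup \<Gamma> (isom_group M d)"
begin

lemma isom_in_carrier: "g \<in> \<Gamma> \<Longrightarrow> x \<in> M \<Longrightarrow> g x \<in> M"
  using subgroup.subset[OF subgroup] by (auto simp: isom_group_def dest: Bij_imp_funcset)

lemma isom_dist: "g \<in> \<Gamma> \<Longrightarrow> x \<in> M \<Longrightarrow> y \<in> M \<Longrightarrow> d (g x) (g y) = d x y"
  using subgroup.subset[OF subgroup] by (auto simp: isom_group_def)

lemma id_in_group: "(\<lambda>x\<in>M. x) \<in> \<Gamma>"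
  using subgroup.one_closed[OF subgroup] by (simp add: isom_group_def BijGroup_def)

lemma compose_in_group:
  assumes "g \<in> \<Gamma>" "h \<in> \<Gamma>"
  shows "compose M g h \<in> \<Gamma>"
proof -
  have "g \<in> Bij M" "h \<in> Bij M"
    using subgroup.subset[OF subgroup] assms by (auto simp: isom_group_def)
  then show ?thesis
    using subgroup.m_closed[OF subgroup assms] by (simp add: isom_group_def BijGroup_def)
qed

lemma inverse_in_group:
  assumes "g \<in> \<Gamma>"
  shows "\<exists>h\<in>\<Gamma>. \<forall>x\<in>M. h (g x) = x \<and> g (h x) = x"
proof -
  interpret I: group "isom_group M d" by (rule group_isom_group)
  let ?h = "inv\<^bsub>isom_group M d\<^esub> g"
  have h: "?h \<in> \<Gamma>" using subgroup.m_inv_closed[OF subgroup assms] .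
  have mem: "g \<in> carrier (isom_group M d)" "?h \<in> carrier (isom_group M d)"
    using subgroup.subset[OF subgroup] assms h by auto
  then have bij: "g \<in> Bij M" "?h \<in> Bij M" by (auto simp: isom_group_def)
  have "compose M ?h g = (\<lambda>x\<in>M. x)" "compose M g ?h = (\<lambda>x\<in>M. x)"
    using I.l_inv[OF mem(1)] I.r_inv[OF mem(1)] bij by (simp_all add: isom_group_def BijGroup_def)
  then have "?h (g x) = x \<and> g (?h x) = x" if "x \<in> M" for x
    using that by (metis compose_eq restrict_apply')
  then show ?thesis using h by blast
qed

section \<open>Orbits of lines and the quotient flow\<close>

abbreviation "line_orbit \<equiv> orbit (isom_subgroup M d \<Gamma>) (\<lambda>g c. g \<circ> c)"

lemma translate_lines: "g \<in> \<Gamma> \<Longrightarrow> c \<in> lines \<Longrightarrow> g \<circ> c \<in> lines"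
  by (auto simp: geodesic_lines_def isom_in_carrier isom_dist image_subset_iff)

text \<open>The group multiplies by the extensional \<open>compose M\<close>, but acts on lines by
  plain composition. The two agree because lines never leave \<open>M\<close>.\<close>

lemma line_orbit_translate:
  assumes "g \<in> \<Gamma>" "c \<in> lines"
  shows "line_orbit (g \<circ> c) = line_orbit c"
proof (intro equalityI subsetI)
  fix c' assume "c' \<in> line_orbit (g \<circ> c)"
  then obtain k where k: "k \<in> \<Gamma>" "c' = k \<circ> (g \<circ> c)" by (auto simp: orbit_def)
  then have "c' = compose M k g \<circ> c"
    using lines_in_carrier[OF assms(2)] by (auto simp: compose_def)
  then show "c' \<in> line_orbit c" using compose_in_group[OF k(1) assms(1)] by (auto simp: orbit_def)
next
  fix c' assume "c' \<in> line_orbit c"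
  then obtain k where k: "k \<in> \<Gamma>" "c' = k \<circ> c" by (auto simp: orbit_def)
  obtain h where h: "h \<in> \<Gamma>" "\<forall>x\<in>M. h (g x) = x"
    using inverse_in_group[OF assms(1)] by blast
  have "c' = compose M k h \<circ> (g \<circ> c)"
    using lines_in_carrier[OF assms(2)] h isom_in_carrier[OF assms(1)] k by (auto simp: compose_def)
  then show "c' \<in> line_orbit (g \<circ> c)" using compose_in_group[OF k(1) h(1)] by (auto simp: orbit_def)
qed

lemma line_orbit_eqD:
  assumes "c' \<in> lines" "line_orbit c = line_orbit c'"
  obtains g where "g \<in> \<Gamma>" "c' = g \<circ> c"
proof -
  have "c' = (\<lambda>x\<in>M. x) \<circ> c'" using lines_in_carrier[OF assms(1)] by auto
  then have "c' \<in> line_orbit c'" using id_in_group by (auto simp: orbit_def)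
  then show ?thesis using that assms(2) by (auto simp: orbit_def)
qed

lemma geod_dist_translate:
  assumes "g \<in> \<Gamma>" "c \<in> lines" "c' \<in> lines"
  shows "gd (g \<circ> c) (g \<circ> c') = gd c c'"
  using assms translate_lines[OF assms(1,2)] translate_lines[OF assms(1,3)] lines_in_carrier
  by (simp add: geod_dist_def isom_dist)

text \<open>Orbits lie a positive distance apart because discreteness leaves only finitely many
  translates of \<open>z\<close> within distance 1 of \<open>y\<close> at time 0; all others are
  farther away already there.\<close>

lemma metrizable_geod_quotient:
  assumes discrete: "discrete_isoms M d \<Gamma>"
  shows "metrizable_space (geod_quotient M d \<Gamma>)"
  unfolding geod_quotient_def geod_topology_eq_mtopology
proof (rule metrizable_quotient_topology[OF Metric_space_geod_dist])
  interpret L: Metric_space lines gd by (rule Metric_space_geod_dist)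
  fix y y' z assume "y \<in> lines" "y' \<in> lines" "z \<in> lines" "line_orbit y = line_orbit y'"
  then show "\<exists>z'\<in>lines. line_orbit z' = line_orbit z \<and> gd y' z' = gd y z"
    by (metis line_orbit_eqD line_orbit_translate translate_lines geod_dist_translate)
next
  interpret L: Metric_space lines gd by (rule Metric_space_geod_dist)
  fix y z assume yz: "y \<in> lines" "z \<in> lines" "line_orbit y \<noteq> line_orbit z"
  define S where "S = {g \<in> \<Gamma>. d (y 0) (g (z 0)) \<le> 1}"
  have in_M: "y 0 \<in> M" "z 0 \<in> M" using yz lines_in_carrier by auto
  have "S \<subseteq> {g \<in> \<Gamma>. d (z 0) (g (z 0)) \<le> d (z 0) (y 0) + 1}"
    using triangle[of "z 0" "y 0"] in_M isom_in_carrier unfolding S_def by force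
  then have fin: "finite S"
    using discrete in_M unfolding discrete_isoms_def
    by (meson add_nonneg_nonneg finite_subset nonneg zero_le_one)
  \<comment> \<open>The inserted 1 is the lower bound for translates outside \<open>S\<close>, and
    it keeps the set nonempty when \<open>S\<close> is empty.\<close>
  define e where "e = Min (insert 1 ((\<lambda>g. gd y (g \<circ> z)) ` S))"
  have "0 < gd y (g \<circ> z)" if "g \<in> \<Gamma>" for g
    using yz that translate_lines[OF that yz(2)] line_orbit_translate[OF that yz(2)]
    by (auto intro!: L.mdist_pos_less)
  then have "e > 0" unfolding e_def using fin by (subst Min_gr_iff) (auto simp: S_def)
  moreover have "e \<le> gd y z'" if z': "z' \<in> lines" "line_orbit z' = line_orbit z" for z'
  proof -
    obtain g where g: "g \<in> \<Gamma>" "z' = g \<circ> z" using z' by (metis line_orbit_eqD)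
    show ?thesis
    proof (cases "g \<in> S")
      case True
      then show ?thesis unfolding e_def using fin g by (intro Min_le) auto
    next
      case False
      then have "1 \<le> gd y z'" using geod_dist_upper[OF yz(1) z'(1), of 0] g by (simp add: S_def)
      moreover have "e \<le> 1" unfolding e_def using fin by (intro Min_le) auto
      ultimately show ?thesis by simp
    qed
  qed
  ultimately show "\<exists>e>0. \<forall>z'\<in>lines. line_orbit z' = line_orbit z \<longrightarrow> e \<le> gd y z'" by blast
qed

lemma continuous_map_geod_quotient_flow:
  "continuous_map (geod_quotient M d \<Gamma>) (geod_quotient M d \<Gamma>) (geod_quotient_flow a)"
proof -
  have "continuous_map (geod_topology M d) (geod_quotient M d \<Gamma>) (line_orbit \<circ> geod_flow a)"
    unfolding geod_quotient_def
    by (rule continuous_map_compose[OF continuous_map_geod_flow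
          quotient_imp_continuous_map[OF quotient_map_quotient_topology]])
  then have "continuous_map (geod_topology M d) (geod_quotient M d \<Gamma>) (geod_quotient_flow a \<circ> line_orbit)"
    by (simp only: comp_def[of line_orbit] comp_def[of _ line_orbit] geod_quotient_flow_orbit)
  then show ?thesis
    unfolding geod_quotient_def by (rule continuous_compose_quotient_map[OF quotient_map_quotient_topology])
qed

section \<open>Point orbits: coboundedness, growth, discreteness, limit points\<close>

lemma isom_orbit_translate:
  assumes "g \<in> \<Gamma>" "x \<in> M"
  shows "isom_orbit M d \<Gamma> (g x) = isom_orbit M d \<Gamma> x"
proof (intro equalityI subsetI)
  fix y assume "y \<in> isom_orbit M d \<Gamma> (g x)"
  then obtain k where k: "k \<in> \<Gamma>" "y = k (g x)" by (auto simp: orbit_def)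
  then have "y = compose M k g x" using assms by (simp add: compose_eq)
  then show "y \<in> isom_orbit M d \<Gamma> x" using compose_in_group[OF k(1) assms(1)] by (auto simp: orbit_def)
next
  fix y assume "y \<in> isom_orbit M d \<Gamma> x"
  then obtain k where k: "k \<in> \<Gamma>" "y = k x" by (auto simp: orbit_def)
  obtain h where h: "h \<in> \<Gamma>" "\<forall>x\<in>M. h (g x) = x"
    using inverse_in_group[OF assms(1)] by blast
  then have "y = compose M k h (g x)" using assms k isom_in_carrier by (simp add: compose_eq)
  then show "y \<in> isom_orbit M d \<Gamma> (g x)" using compose_in_group[OF k(1) h(1)] by (auto simp: orbit_def)
qed

text \<open>A closed ball that meets every orbit is compact by properness, and it maps onto the
  quotient.\<close>

lemma cocompact_if_cobounded:
  assumes "proper_metric M d" "p \<in> M" "\<And>x. x \<in> M \<Longrightarrow> \<exists>g\<in>\<Gamma>. d p (g x) \<le> C"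
  shows "cocompact M d \<Gamma>"
proof -
  let ?q = "isom_orbit M d \<Gamma>"
  have "compactin mtopology (mcball p C)" using assms(1,2) by (simp add: proper_metric_def)
  then have "compactin (quotient_topology mtopology ?q) (?q ` mcball p C)"
    by (rule image_compactin) (rule quotient_imp_continuous_map[OF quotient_map_quotient_topology])
  moreover have "?q ` mcball p C = ?q ` M"
  proof
    show "?q ` M \<subseteq> ?q ` mcball p C"
    proof clarify
      fix x assume x: "x \<in> M"
      then obtain g where "g \<in> \<Gamma>" "d p (g x) \<le> C" using assms(3) by blast
      then have "?q x = ?q (g x)" "g x \<in> mcball p C"
        using x assms(2) isom_orbit_translate isom_in_carrier by auto
      then show "?q x \<in> ?q ` mcball p C" by blast
    qed
  qed auto
  ultimately show ?thesis
    by (simp add: cocompact_def compact_space_def topspace_quotient_topology)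
qed

text \<open>Every ball of radius \<open>R\<close> is carried by the group into the single compact
  ball of radius \<open>C + R\<close> around \<open>p\<close>. A finite cover of the latter is
  pulled back by the inverse isometry without gaining members.\<close>

lemma bounded_geometry_if_cobounded:
  assumes "proper_metric M d" "p \<in> M" "\<And>x. x \<in> M \<Longrightarrow> \<exists>g\<in>\<Gamma>. d p (g x) \<le> C"
  shows "bounded_geometry M d"
  unfolding bounded_geometry_def
proof (intro allI impI, elim conjE)
  fix r R :: real assume r: "0 < r" "r \<le> R"
  have "compactin mtopology (mcball p (C + R))" using assms(1,2) by (simp add: proper_metric_def)
  then have "mtotally_bounded (mcball p (C + R))" by (rule compactin_imp_mtotally_bounded)
  then have "\<exists>F. finite F \<and> F \<subseteq> mcball p (C + R) \<and> mcball p (C + R) \<subseteq> (\<Union>x\<in>F. mball x r)"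
    using r(1) unfolding mtotally_bounded_def by (elim allE[of _ r]) (erule mp)
  then obtain F where F: "finite F" "F \<subseteq> mcball p (C + R)" "mcball p (C + R) \<subseteq> (\<Union>x\<in>F. mball x r)"
    by (elim exE conjE) (rule that)
  have "covering_number M d (mcball x R) r \<le> enat (card F)" if x: "x \<in> M" for x
  proof -
    obtain g where g: "g \<in> \<Gamma>" "d p (g x) \<le> C" using assms(3) x by blast
    obtain h where h: "h \<in> \<Gamma>" "\<forall>x\<in>M. h (g x) = x"
      using inverse_in_group[OF g(1)] by blast
    have "mcball x R \<subseteq> (\<Union>c\<in>h ` F. mball c r)"
    proof
      fix y assume y: "y \<in> mcball x R"
      then have "d p (g y) \<le> C + R"
        using triangle[of p "g x" "g y"] isom_in_carrier[OF g(1)] isom_dist[OF g(1)] g x assms(2) by simp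
      then have "g y \<in> mcball p (C + R)" using y isom_in_carrier[OF g(1)] assms(2) by simp
      then obtain f where f: "f \<in> F" "g y \<in> mball f r" using F(3) by blast
      then have "d (h f) (h (g y)) < r" using isom_dist[OF h(1)] by simp
      then have "y \<in> mball (h f) r" using h f y isom_in_carrier[OF h(1)] by simp
      then show "y \<in> (\<Union>c\<in>h ` F. mball c r)" using f by blast
    qed
    moreover have "h ` F \<subseteq> M" using F(2) isom_in_carrier[OF h(1)] by auto
    ultimately have "covering_number M d (mcball x R) r \<le> enat (card (h ` F))"
      using F(1) by (intro covering_number_le) auto
    also have "\<dots> \<le> enat (card F)" using card_image_le[OF F(1)] by simp
    finally show ?thesis .
  qed
  then have "(SUP x\<in>M. covering_number M d (mcball x R) r) \<le> enat (card F)" by (rule SUP_least)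
  then show "(SUP x\<in>M. covering_number M d (mcball x R) r) < \<infinity>"
    using enat_ord_code(4) order_le_less_trans by blast
qed

text \<open>Orbit points are at most as many as group elements, and measuring displacement at
  \<open>p\<close> instead of \<open>x\<close> shifts the radius by a constant, which disappears
  after division by \<open>T\<close>.\<close>

lemma critical_exponent_le:
  assumes fin: "\<And>n::nat. finite {g \<in> \<Gamma>. d p (g p) \<le> real n}"
    and growth: "\<And>n::nat. card {g \<in> \<Gamma>. d p (g p) \<le> real n} \<le> b ^ (n + 1)"
    and b: "b > 0" and p: "p \<in> M" and x: "x \<in> M"
  shows "critical_exponent M d \<Gamma> x \<le> ereal (ln (real b))"
proof -
  \<comment> \<open>The change of base point costs \<open>2 * d p x\<close>, rounding the radius up
    to \<open>n\<close> costs 1, and the exponent \<open>n + 1\<close> one more.\<close>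
  define k where "k = 2 * d p x + 2"
  have "critical_exponent M d \<Gamma> x \<le> Limsup at_top (\<lambda>T::real. ereal (ln b + k * ln b * inverse T))"
    unfolding critical_exponent_def
  proof (rule Limsup_mono)
    show "\<forall>\<^sub>F T::real in at_top. ereal (1 / T * ln (real (card (isom_orbit M d \<Gamma> x \<inter> mball x T))))
        \<le> ereal (ln b + k * ln b * inverse T)"
      using eventually_gt_at_top[of 0]
    proof eventually_elim
      case (elim T)
      define n where "n = nat \<lceil>T + 2 * d p x\<rceil>"
      have n: "T + 2 * d p x \<le> real n" "real n \<le> T + 2 * d p x + 1"
        unfolding n_def using elim nonneg[of p x] by linarith+
      have "isom_orbit M d \<Gamma> x \<inter> mball x T \<subseteq> (\<lambda>g. g x) ` {g \<in> \<Gamma>. d p (g p) \<le> real n}"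
      proof
        fix y assume "y \<in> isom_orbit M d \<Gamma> x \<inter> mball x T"
        then obtain g where g: "g \<in> \<Gamma>" "y = g x" "d x (g x) < T" by (auto simp: orbit_def)
        have "d p (g p) \<le> d p x + d x (g x) + d (g x) (g p)"
          using triangle[of p x "g p"] triangle[of x "g x" "g p"] g p x isom_in_carrier by simp
        also have "\<dots> \<le> real n" using n(1) g p x isom_dist by (simp add: commute)
        finally show "y \<in> (\<lambda>g. g x) ` {g \<in> \<Gamma>. d p (g p) \<le> real n}" using g by auto
      qed
      then have "card (isom_orbit M d \<Gamma> x \<inter> mball x T) \<le> card {g \<in> \<Gamma>. d p (g p) \<le> real n}"
        using fin by (meson card_image_le card_mono finite_imageI order_trans)
      also have "\<dots> \<le> b ^ (n + 1)" by (rule growth)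
      finally have le: "real (card (isom_orbit M d \<Gamma> x \<inter> mball x T)) \<le> real b ^ (n + 1)"
        by (metis of_nat_le_iff of_nat_power)
      have "ln (real (card (isom_orbit M d \<Gamma> x \<inter> mball x T))) \<le> ln (real b ^ (n + 1))"
      \<comment> \<open>\<open>ln\<close> is monotone only on positive arguments; a count of 0
        enters as \<open>ln 0 = 0\<close>.\<close>
      proof (cases "card (isom_orbit M d \<Gamma> x \<inter> mball x T) = 0")
        case True
        then show ?thesis using b by (simp del: power_Suc)
      next
        case False
        then show ?thesis using le by (subst ln_le_cancel_iff) (use b in auto)
      qed
      also have "\<dots> = real (n + 1) * ln b" using b by (simp add: ln_realpow del: power_Suc)
      also have "\<dots> \<le> (T + k) * ln b" using n b by (intro mult_right_mono) (auto simp: k_def)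
      finally have "1 / T * ln (real (card (isom_orbit M d \<Gamma> x \<inter> mball x T))) \<le> 1 / T * ((T + k) * ln b)"
        using elim by (intro mult_left_mono) auto
      also have "\<dots> = ln b + k * ln b * inverse T" using elim by (simp add: field_simps)
      finally show ?case by simp
    qed
  qed
  moreover have "((\<lambda>T::real. ln b + k * ln b * inverse T) \<longlongrightarrow> ln b + k * ln b * 0) at_top"
    by (intro tendsto_intros tendsto_inverse_0_at_top filterlim_ident)
  then have "Limsup at_top (\<lambda>T::real. ereal (ln b + k * ln b * inverse T)) = ereal (ln b)"
    by (intro lim_imp_Limsup) auto
  ultimately show ?thesis by simp
qed

lemma discrete_if_finite_at:
  assumes p: "p \<in> M" and fin: "\<And>n::nat. finite {g \<in> \<Gamma>. d p (g p) \<le> real n}"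
  shows "discrete_isoms M d \<Gamma>"
  unfolding discrete_isoms_def
proof (intro ballI allI impI)
  fix x R assume x: "x \<in> M" and "0 \<le> (R::real)"
  have "{g \<in> \<Gamma>. d x (g x) \<le> R} \<subseteq> {g \<in> \<Gamma>. d p (g p) \<le> real (nat \<lceil>R + 2 * d p x\<rceil>)}"
  proof clarify
    fix g assume g: "g \<in> \<Gamma>" "d x (g x) \<le> R"
    have "d p (g p) \<le> d p x + d x (g x) + d (g x) (g p)"
      using triangle[of p x "g p"] triangle[of x "g x" "g p"] g p x isom_in_carrier by simp
    also have "\<dots> \<le> R + 2 * d p x" using g p x isom_dist by (simp add: commute)
    finally show "d p (g p) \<le> real (nat \<lceil>R + 2 * d p x\<rceil>)" by linarith
  qed
  then show "finite {g \<in> \<Gamma>. d x (g x) \<le> R}" using fin finite_subset by blast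
qed

text \<open>Non-elementarity is asked for every orbit and every base point; this reduces both to the
  orbit of \<open>p\<close> seen from \<open>p\<close>. Two of the three distances move by at most
  \<open>d p x + d p w\<close> and the third by \<open>2 * d p x\<close>; half of the total is the
  bound.\<close>

lemma gromov_product_orbit_coarse:
  assumes "g \<in> \<Gamma>" "h \<in> \<Gamma>" "p \<in> M" "x \<in> M" "w \<in> M"
  shows "\<bar>gromov_product d w (g x) (h x) - gromov_product d p (g p) (h p)\<bar> \<le> 2 * d p x + d p w"
proof -
  note in_M = isom_in_carrier[OF assms(1)] isom_in_carrier[OF assms(2)] assms(3-5)
  have gh: "d (g x) (g p) = d p x" "d (h x) (h p) = d p x"
    using assms isom_dist by (simp_all add: commute)
  have "\<bar>d w (g x) - d p (g p)\<bar> \<le> d p x + d p w" "\<bar>d w (h x) - d p (h p)\<bar> \<le> d p x + d p w"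
    "\<bar>d (g x) (h x) - d (g p) (h p)\<bar> \<le> 2 * d p x"
    using gh triangle[of w p "g x"] triangle[of p "g p" "g x"] triangle[of p w "g p"] triangle[of w "g x" "g p"]
      triangle[of w p "h x"] triangle[of p "h p" "h x"] triangle[of p w "h p"] triangle[of w "h x" "h p"]
      triangle[of "g x" "g p" "h x"] triangle[of "g p" "h p" "h x"]
      triangle[of "g p" "g x" "h p"] triangle[of "g x" "h x" "h p"]
      in_M commute[of w p] commute[of "g p" "g x"] commute[of "h p" "h x"]
    by (simp_all add: abs_le_iff)
  then show ?thesis unfolding gromov_product_def by (simp add: abs_le_iff field_simps)
qed

end

section \<open>The Cayley tree of the free group of rank two\<close>

text \<open>
  The generators and their inverses are the reals \<open>1, 2, -1, -2\<close>, inversion of letters being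
  negation. A point of the tree is coded by \<open>s # w\<close>: it lies at distance \<open>s\<close> from the root, and
  \<open>w\<close> is the shortest reduced word such that the path from the root to the vertex \<open>w\<close> contains it.
\<close>

definition letters :: "real set" where
  "letters = {1, -1, 2, -2}"

definition reduced_word :: "real list \<Rightarrow> bool" where
  "reduced_word w \<longleftrightarrow> set w \<subseteq> letters \<and> successively (\<lambda>a b. b \<noteq> - a) w"

definition tree :: "real list set" where
  "tree = {s # w | s w. reduced_word w \<and> 0 \<le> s \<and> length w = nat \<lceil>s\<rceil>}"

fun lcp :: "'a list \<Rightarrow> 'a list \<Rightarrow> nat" where
  "lcp (x # xs) (y # ys) = (if x = y then Suc (lcp xs ys) else 0)"
| "lcp _ _ = 0"

text \<open>The length along which the paths from the root to the two points coincide, that is,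
  their Gromov product at the root. The word of a point inside an edge reaches beyond the point,
  hence the minimum with both heights.\<close>

definition meet :: "real list \<Rightarrow> real list \<Rightarrow> real" where
  "meet p q = min (min (hd p) (hd q)) (real (lcp (tl p) (tl q)))"

definition tdist :: "real list \<Rightarrow> real list \<Rightarrow> real" where
  "tdist p q = hd p + hd q - 2 * meet p q"

text \<open>For \<open>0 \<le> s \<le> length w\<close>, the point at height \<open>s\<close> on the
  path from the root to the vertex \<open>w\<close>.\<close>

definition tpath :: "real list \<Rightarrow> real \<Rightarrow> real list" where
  "tpath w s = s # take (nat \<lceil>s\<rceil>) w"

lemma finite_letters: "finite letters" and card_letters: "card letters = 4"
  by (simp_all add: letters_def)

lemma neg_letter [simp]: "- a \<in> letters \<longleftrightarrow> a \<in> letters"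
  by (auto simp: letters_def)

lemma letter_neq_neg: "a \<in> letters \<Longrightarrow> a \<noteq> - a"
  by (auto simp: letters_def)

lemma reduced_Nil [simp]: "reduced_word []"
  by (simp add: reduced_word_def)

lemma reduced_Cons: "reduced_word (a # w) \<longleftrightarrow> a \<in> letters \<and> reduced_word w \<and> (w = [] \<or> hd w \<noteq> - a)"
  by (auto simp: reduced_word_def successively_Cons)

lemma reduced_append:
  "reduced_word (u @ v) \<longleftrightarrow> reduced_word u \<and> reduced_word v \<and> (u = [] \<or> v = [] \<or> hd v \<noteq> - last u)"
  by (auto simp: reduced_word_def successively_append_iff)

lemma reduced_replicate: "a \<in> letters \<Longrightarrow> reduced_word (replicate n a)"
  by (induction n) (auto simp: reduced_Cons letters_def)

lemma reduced_take: "reduced_word w \<Longrightarrow> reduced_word (take n w)"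
  by (metis append_take_drop_id reduced_append)

section \<open>Common prefixes\<close>

lemma lcp_commute: "lcp xs ys = lcp ys xs"
  by (induction xs ys rule: lcp.induct) auto

lemma lcp_Nil [simp]: "lcp [] xs = 0" "lcp xs [] = 0"
  by (cases xs; simp)+

lemma lcp_self [simp]: "lcp xs xs = length xs"
  by (induction xs) auto

lemma lcp_ultra: "min (lcp xs ys) (lcp ys zs) \<le> lcp xs zs"
proof (induction xs ys arbitrary: zs rule: lcp.induct)
  case (1 x xs y ys)
  then show ?case by (cases zs) auto
qed auto

lemma lcp_take: "lcp (take m xs) (take n ys) = min (min m n) (lcp xs ys)"
proof (induction xs ys arbitrary: m n rule: lcp.induct)
  case (1 x xs y ys)
  then show ?case by (cases m; cases n) auto
qed auto

lemma eq_if_length_le_lcp: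
  "length xs \<le> lcp xs ys \<Longrightarrow> length ys \<le> lcp xs ys \<Longrightarrow> xs = ys"
  by (induction xs ys rule: lcp.induct) (auto split: if_splits)

section \<open>The tree metric, hyperbolicity and geodesics\<close>

lemma treeE:
  assumes "p \<in> tree"
  obtains s w where "p = s # w" "reduced_word w" "0 \<le> s" "length w = nat \<lceil>s\<rceil>"
  using assms by (auto simp: tree_def)

lemma Cons_in_tree: "s # w \<in> tree \<longleftrightarrow> reduced_word w \<and> 0 \<le> s \<and> length w = nat \<lceil>s\<rceil>"
  by (auto simp: tree_def)

lemma hd_tree_nonneg: "p \<in> tree \<Longrightarrow> 0 \<le> hd p"
  by (auto simp: tree_def)

lemma root_in_tree [simp]: "[0] \<in> tree"
  by (simp add: tree_def)

lemma tpath_in_tree: "\<lbrakk>reduced_word w; 0 \<le> s; s \<le> real (length w)\<rbrakk> \<Longrightarrow> tpath w s \<in> tree"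
  by (auto simp: tpath_def Cons_in_tree reduced_take min_def) linarith

lemma tpath_tree: "s # w \<in> tree \<Longrightarrow> tpath w s = s # w"
  by (simp add: tpath_def Cons_in_tree)

text \<open>Truncating \<open>w\<close> to \<open>nat \<lceil>s\<rceil>\<close> letters does not
  show, because \<open>s\<close> already takes part in the minimum. Distances between points of two
  paths thus depend only on the prefix shared by the full words.\<close>

lemma meet_path:
  assumes "0 \<le> s" "0 \<le> t"
  shows "meet (tpath w s) (tpath v t) = min (min s t) (real (lcp w v))"
proof -
  have "s \<le> real (nat \<lceil>s\<rceil>)" "t \<le> real (nat \<lceil>t\<rceil>)" by linarith+
  then show ?thesis by (simp add: meet_def tpath_def lcp_take min_def)
qed

lemma meet_commute: "meet p q = meet q p"
  by (simp add: meet_def lcp_commute min.commute)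

lemma meet_ultra: "min (meet p q) (meet q r) \<le> meet p r"
  using lcp_ultra[of "tl p" "tl q" "tl r"] by (auto simp: meet_def min_def split: if_splits)

lemma meet_le: "meet p q \<le> hd p" "meet p q \<le> hd q"
  by (simp_all add: meet_def)

lemma meet_self: "p \<in> tree \<Longrightarrow> meet p p = hd p"
  by (auto simp: meet_def tree_def)

lemma meet_root: "p \<in> tree \<Longrightarrow> meet [0] p = 0"
  by (auto simp: meet_def hd_tree_nonneg)

lemma tdist_commute: "tdist p q = tdist q p"
  by (simp add: tdist_def meet_commute)

lemma tdist_nonneg: "0 \<le> tdist p q"
  using meet_le[of p q] by (simp add: tdist_def)

lemma tdist_self: "p \<in> tree \<Longrightarrow> tdist p p = 0"
  by (simp add: tdist_def meet_self)

lemma tdist_root: "p \<in> tree \<Longrightarrow> tdist [0] p = hd p"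
  by (simp add: tdist_def meet_root)

text \<open>The smaller of \<open>meet p q\<close> and \<open>meet q r\<close> is at most
  \<open>meet p r\<close>, and the larger is at most \<open>hd q\<close>.\<close>

lemma tdist_triangle: "tdist p r \<le> tdist p q + tdist q r"
  using meet_ultra[of p q r] meet_le[of p q] meet_le[of q r]
  by (auto simp: tdist_def min_def split: if_splits)

lemma tdist_eq_0:
  assumes "p \<in> tree" "q \<in> tree" "tdist p q = 0"
  shows "p = q"
proof -
  obtain s w where p: "p = s # w" "0 \<le> s" "length w = nat \<lceil>s\<rceil>" using assms(1) by (rule treeE)
  obtain t v where q: "q = t # v" "0 \<le> t" "length v = nat \<lceil>t\<rceil>" using assms(2) by (rule treeE)
  have "s = t" "s \<le> real (lcp w v)"
    using assms(3) p q by (auto simp: tdist_def meet_def min_def split: if_splits)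
  \<comment> \<open>An integer that is at least \<open>s\<close> is at least
    \<open>nat \<lceil>s\<rceil>\<close>, the length of both words.\<close>
  then have "w = v" using p q by (intro eq_if_length_le_lcp) linarith+
  with \<open>s = t\<close> p q show ?thesis by simp
qed

text \<open>Hyperbolicity at an arbitrary base point: seen from the root this is \<open>meet_ultra\<close>.\<close>

lemma meet_four_points:
  "min (meet x y + meet z w) (meet y z + meet x w) \<le> meet x z + meet y w"
  \<comment> \<open>These are the three ultrametric inequalities of each of the four triples. Up to
    \<open>meet_commute\<close> the claim follows from them by linear arithmetic with case
    distinctions.\<close>
  using meet_ultra[of x y z] meet_ultra[of x w z] meet_ultra[of y x w] meet_ultra[of y z w]
    meet_ultra[of x y w] meet_ultra[of x z w] meet_ultra[of z y w] meet_ultra[of z x w]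
    meet_ultra[of x z y] meet_ultra[of x w y] meet_ultra[of y x z] meet_ultra[of y w z]
    meet_commute
  by (smt (verit))

lemma tdist_path:
  assumes "0 \<le> s" "0 \<le> t" "s \<le> real (length w)" "t \<le> real (length w)"
  shows "tdist (tpath w s) (tpath w t) = \<bar>s - t\<bar>"
proof -
  have "hd (tpath w s) = s" "hd (tpath w t) = t" by (simp_all add: tpath_def)
  then show ?thesis unfolding tdist_def by (simp add: meet_path assms min_def)
qed

lemma tree_geodesic:
  assumes p: "p \<in> tree" and q: "q \<in> tree"
  shows "\<exists>c. c ` {0..tdist p q} \<subseteq> tree \<and> c 0 = p \<and> c (tdist p q) = q \<and>
    (\<forall>x\<in>{0..tdist p q}. \<forall>y\<in>{0..tdist p q}. tdist (c x) (c y) = \<bar>x - y\<bar>)"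
proof -
  obtain s w where p': "p = s # w" "reduced_word w" "0 \<le> s" "length w = nat \<lceil>s\<rceil>" using p by (rule treeE)
  obtain t v where q': "q = t # v" "reduced_word v" "0 \<le> t" "length v = nat \<lceil>t\<rceil>" using q by (rule treeE)
  have sw: "s \<le> length w" and tv: "t \<le> length v" using p' q' by linarith+
  define m where "m = meet p q"
  have m: "m = min (min s t) (real (lcp w v))" by (simp add: m_def p' q' meet_def)
  have m0: "0 \<le> m" unfolding m using p' q' by simp
  have ms: "m \<le> s" "m \<le> t" "m \<le> lcp w v" unfolding m by simp_all
  have D: "tdist p q = s + t - 2 * m" by (simp add: tdist_def m_def p' q')
  \<comment> \<open>Down from \<open>p\<close> to the branch point at height \<open>m\<close>, then
    up to \<open>q\<close>: after the turn at time \<open>s - m\<close> the height is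
    \<open>m + (x - (s - m))\<close>.\<close>
  define c where "c x = (if x \<le> s - m then tpath w (s - x) else tpath v (x - s + 2 * m))" for x
  have cross: "tdist (tpath w a) (tpath v b) = a + b - 2 * m"
    if "m \<le> a" "a \<le> s" "m \<le> b" "b \<le> t" for a b
  proof -
    have "meet (tpath w a) (tpath v b) = min (min a b) (real (lcp w v))"
      using that m0 by (intro meet_path) linarith+
    also have "\<dots> = m" using that m by (auto simp: min_def split: if_splits)
    finally show ?thesis by (simp add: tdist_def tpath_def)
  qed
  show ?thesis
  proof (intro exI[of _ c] conjI ballI)
    show "c ` {0..tdist p q} \<subseteq> tree"
    proof clarify
      fix x assume "x \<in> {0..tdist p q}"
      then have x: "0 \<le> x" "x \<le> s + t - 2 * m" by (simp_all add: D)
      show "c x \<in> tree"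
      proof (cases "x \<le> s - m")
        case True
        have "tpath w (s - x) \<in> tree" using p'(2) by (rule tpath_in_tree) (use True x m0 sw in linarith)+
        then show ?thesis using True by (simp add: c_def)
      next
        case False
        have "tpath v (x - s + 2 * m) \<in> tree"
          using q'(2) by (rule tpath_in_tree) (use False x m0 tv in linarith)+
        then show ?thesis using False by (simp add: c_def)
      qed
    qed
    show "c 0 = p" unfolding c_def using ms p p' by (simp add: tpath_tree)
    show "c (tdist p q) = q"
    \<comment> \<open>If \<open>q\<close> is itself the branch point, the path never turns and ends
      on \<open>w\<close>; its endpoint has to be identified with the point of \<open>v\<close> at
      height \<open>m\<close>.\<close>
    proof (cases "t = m")
      case True
      have "tdist (tpath w m) (tpath v m) = 0" using cross[of m m] ms by simp
      moreover have "tpath w m \<in> tree" using p'(2) by (rule tpath_in_tree) (use m0 ms sw in linarith)+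
      moreover have "tpath v m \<in> tree" using q'(2) by (rule tpath_in_tree) (use m0 ms tv in linarith)+
      ultimately have "tpath w m = tpath v m" by (intro tdist_eq_0)
      then show ?thesis unfolding c_def D using True q q' by (simp add: tpath_tree)
    next
      case False
      then show ?thesis unfolding c_def D using ms q q' by (simp add: tpath_tree)
    qed
    fix x y assume "x \<in> {0..tdist p q}" "y \<in> {0..tdist p q}"
    then have xy: "0 \<le> x" "x \<le> s + t - 2 * m" "0 \<le> y" "y \<le> s + t - 2 * m" by (simp_all add: D)
    consider "x \<le> s - m" "y \<le> s - m" | "x \<le> s - m" "y > s - m"
      | "x > s - m" "y \<le> s - m" | "x > s - m" "y > s - m" by linarith
    then show "tdist (c x) (c y) = \<bar>x - y\<bar>"
    proof cases
      case 1
      have "tdist (tpath w (s - x)) (tpath w (s - y)) = \<bar>(s - x) - (s - y)\<bar>"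
        using 1 xy m0 sw by (intro tdist_path) linarith+
      then show ?thesis using 1 by (simp add: c_def)
    next
      case 2
      have "tdist (tpath w (s - x)) (tpath v (y - s + 2 * m)) = (s - x) + (y - s + 2 * m) - 2 * m"
        using 2 xy by (intro cross) linarith+
      then show ?thesis using 2 by (simp add: c_def)
    next
      case 3
      have "tdist (tpath w (s - y)) (tpath v (x - s + 2 * m)) = (s - y) + (x - s + 2 * m) - 2 * m"
        using 3 xy by (intro cross) linarith+
      then show ?thesis using 3 by (simp add: c_def tdist_commute)
    next
      case 4
      have "tdist (tpath v (x - s + 2 * m)) (tpath v (y - s + 2 * m)) =
          \<bar>(x - s + 2 * m) - (y - s + 2 * m)\<bar>"
        using 4 xy m0 tv by (intro tdist_path) linarith+
      then show ?thesis using 4 by (simp add: c_def)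
    qed
  qed
qed

section \<open>The action of the free group on its tree\<close>

text \<open>Left multiplication by \<open>a\<close>, extended to the edges. A leading
  \<open>- a\<close> cancels. Points of the edge from the root to \<open>- a\<close> at height below
  1 land on the edge from the root to \<open>a\<close>, with the orientation reversed.\<close>

definition act :: "real \<Rightarrow> real list \<Rightarrow> real list" where
  "act a p = (if tl p \<noteq> [] \<and> hd (tl p) = - a
     then if hd p \<ge> 1 then (hd p - 1) # tl (tl p) else [1 - hd p, a]
     else (hd p + 1) # a # tl p)"

definition acts :: "real list \<Rightarrow> real list \<Rightarrow> real list" where
  "acts u = foldr act u"

lemma acts_simps [simp]: "acts [] p = p" "acts (a # u) p = act a (acts u p)"
  "acts (u @ v) p = acts u (acts v p)"
  by (simp_all add: acts_def)

lemma tree_cases: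
  assumes "p \<in> tree" "a \<in> letters"
  obtains (grow) s w where "p = s # w" "reduced_word (a # w)" "act a p = (s + 1) # a # w"
  | (shrink) s w where "p = s # - a # w" "1 \<le> s" "reduced_word w" "w = [] \<or> hd w \<noteq> a" "act a p = (s - 1) # w"
  | (flip) s where "p = [s, - a]" "0 < s" "s < 1" "act a p = [1 - s, a]"
proof -
  obtain s w where p: "p = s # w" "reduced_word w" "0 \<le> s" "length w = nat \<lceil>s\<rceil>" using assms(1) by (rule treeE)
  show thesis
  proof (cases "w \<noteq> [] \<and> hd w = - a")
    case False
    then show thesis using p assms(2) by (intro grow[of s w]) (auto simp: reduced_Cons act_def)
  next
    case True
    then obtain v where v: "w = - a # v" by (cases w) auto
    show thesis
    proof (cases "s \<ge> 1")
      case True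
      then show thesis using p v by (intro shrink[of s v]) (auto simp: reduced_Cons act_def)
    next
      case False
      have "s \<noteq> 0" using p v by auto
      moreover have "length w \<le> 1" using False p(4) by linarith
      ultimately show thesis using p v False by (intro flip[of s]) (auto simp: act_def)
    qed
  qed
qed

lemma act_in_tree:
  assumes "p \<in> tree" "a \<in> letters"
  shows "act a p \<in> tree"
  using assms
proof (cases rule: tree_cases)
  case (grow s w)
  then show ?thesis using assms by (auto simp: Cons_in_tree) linarith
next
  case (shrink s w)
  then show ?thesis using assms by (auto simp: Cons_in_tree) linarith
next
  case (flip s)
  have "\<lceil>1 - s\<rceil> = 1" using flip by linarith
  then show ?thesis using flip assms by (auto simp: Cons_in_tree reduced_Cons)
qed

lemma act_act_neg:
  assumes "p \<in> tree" "a \<in> letters"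
  shows "act a (act (- a) p) = p"
proof -
  have "- a \<in> letters" using assms by simp
  with assms(1) show ?thesis
  proof (cases rule: tree_cases)
    case (grow s w)
    then show ?thesis using hd_tree_nonneg[OF assms(1)] by (simp add: act_def)
  next
    case (shrink s w)
    then show ?thesis by (auto simp: act_def)
  next
    case (flip s)
    then show ?thesis by (simp add: act_def)
  qed
qed

text \<open>For two growing or two shrinking points the heights and \<open>meet\<close> change by
  the same 1. A growing and a shrinking point share no first letter before or after. A flipped point
  lies on the edge to \<open>- a\<close> before, together with paths of shrinking points, and on the
  edge to \<open>a\<close> after, together with paths of growing points; the changes of height
  compensate.\<close>

lemma act_isometry:
  assumes "p \<in> tree" "q \<in> tree" "a \<in> letters"
  shows "tdist (act a p) (act a q) = tdist p q"
proof -
  have neq: "a \<noteq> - a" "- a \<noteq> a" using letter_neq_neg[OF assms(3)] by auto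
  have lcp0: "lcp w (b # v) = 0" "lcp (b # v) w = 0" if "w = [] \<or> hd w \<noteq> b" for w v and b :: real
    using that by (cases w; auto)+
  have nn: "0 \<le> hd p" "0 \<le> hd q" using assms hd_tree_nonneg by auto
  from assms(1,3) show ?thesis
  proof (cases rule: tree_cases)
    case p: (grow s w)
    from assms(2,3) show ?thesis
    proof (cases rule: tree_cases)
      case (grow t v)
      then show ?thesis using p by (auto simp: tdist_def meet_def min_def)
    next
      case (shrink t v)
      then show ?thesis using p nn by (auto simp: tdist_def meet_def reduced_Cons lcp0)
    next
      case (flip t)
      then show ?thesis using p nn by (auto simp: tdist_def meet_def reduced_Cons lcp0 min_def)
    qed
  next
    case p: (shrink s w)
    from assms(2,3) show ?thesis
    proof (cases rule: tree_cases)
      case (grow t v)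
      then show ?thesis using p nn by (auto simp: tdist_def meet_def reduced_Cons lcp0)
    next
      case (shrink t v)
      then show ?thesis using p by (auto simp: tdist_def meet_def min_def)
    next
      case (flip t)
      then show ?thesis using p nn by (auto simp: tdist_def meet_def reduced_Cons lcp0 min_def)
    qed
  next
    case p: (flip s)
    from assms(2,3) show ?thesis
    proof (cases rule: tree_cases)
      case (grow t v)
      then show ?thesis using p nn by (auto simp: tdist_def meet_def reduced_Cons lcp0 min_def)
    next
      case (shrink t v)
      then show ?thesis using p by (auto simp: tdist_def meet_def min_def lcp0)
    next
      case (flip t)
      then show ?thesis using p nn by (auto simp: tdist_def meet_def reduced_Cons lcp0 min_def)
    qed
  qed
qed

lemma acts_in_tree: "set u \<subseteq> letters \<Longrightarrow> p \<in> tree \<Longrightarrow> acts u p \<in> tree"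
  by (induction u) (auto simp: act_in_tree)

lemma acts_isometry:
  "set u \<subseteq> letters \<Longrightarrow> p \<in> tree \<Longrightarrow> q \<in> tree \<Longrightarrow> tdist (acts u p) (acts u q) = tdist p q"
  by (induction u) (auto simp: act_isometry acts_in_tree)

section \<open>Inverse words, reduction and powers\<close>

definition inverse_word :: "real list \<Rightarrow> real list" where
  "inverse_word u = rev (map uminus u)"

lemma inverse_word_letters: "set u \<subseteq> letters \<Longrightarrow> set (inverse_word u) \<subseteq> letters"
  by (auto simp: inverse_word_def)

lemma acts_inverse_word:
  "set u \<subseteq> letters \<Longrightarrow> p \<in> tree \<Longrightarrow> acts (inverse_word u) (acts u p) = p"
proof (induction u)
  case (Cons a u)
  then have "act (- a) (act a (acts u p)) = acts u p"
    using act_act_neg[of "acts u p" "- a"] by (simp add: acts_in_tree)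
  then show ?case using Cons by (simp add: inverse_word_def)
qed (simp add: inverse_word_def)

lemma acts_inverse_word':
  assumes "set u \<subseteq> letters" "p \<in> tree"
  shows "acts u (acts (inverse_word u) p) = p"
proof -
  have "inverse_word (inverse_word u) = u" by (simp add: inverse_word_def rev_map comp_def)
  then show ?thesis
    using acts_inverse_word[OF inverse_word_letters[OF assms(1)] assms(2)] by simp
qed

text \<open>Free cancellation at the head of the word. Reduced representatives matter because they
  can be read off from the image of the root.\<close>

lemma exists_reduced:
  assumes "set u \<subseteq> letters"
  shows "\<exists>w. reduced_word w \<and> (\<forall>p\<in>tree. acts w p = acts u p)"
  using assms
proof (induction u)
  case (Cons a u)
  then obtain w where w: "reduced_word w" "\<forall>p\<in>tree. acts w p = acts u p" by auto
  have a: "a \<in> letters" using Cons by simp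
  show ?case
  proof (cases "w \<noteq> [] \<and> hd w = - a")
    case True
    then obtain v where v: "w = - a # v" by (cases w) auto
    have "acts v p = acts (a # u) p" if "p \<in> tree" for p
    proof -
      have "acts v p \<in> tree" using w(1) v that by (intro acts_in_tree) (auto simp: reduced_word_def)
      then show ?thesis using w(2) v that a act_act_neg[of "acts v p" a] by (auto dest!: bspec[of _ _ p])
    qed
    then show ?thesis using w(1) v by (auto simp: reduced_Cons)
  next
    case False
    then show ?thesis using w a by (intro exI[of _ "a # w"]) (auto simp: reduced_Cons)
  qed
qed (auto intro: exI[of _ "[]"])

lemma acts_root: "reduced_word w \<Longrightarrow> acts w [0] = real (length w) # w"
  by (induction w) (auto simp: reduced_Cons act_def)

lemma acts_to_root:
  assumes "p \<in> tree"
  shows "\<exists>u. set u \<subseteq> letters \<and> hd (acts u p) \<le> 1"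
proof -
  obtain s w where p: "p = s # w" "reduced_word w" "0 \<le> s" "length w = nat \<lceil>s\<rceil>" using assms by (rule treeE)
  \<comment> \<open>The exact length is relaxed to an inequality, which persists when one letter and
    one unit of height are removed.\<close>
  have "\<exists>u. set u \<subseteq> letters \<and> hd (acts u (s # w)) \<le> 1"
    if "reduced_word w" "s \<le> real (length w)" for w and s :: real
    using that
  proof (induction w arbitrary: s)
    case Nil
    then show ?case by (intro exI[of _ "[]"]) simp
  next
    case (Cons a w)
    show ?case
    proof (cases "s \<le> 1")
      case True
      then show ?thesis by (intro exI[of _ "[]"]) simp
    next
      case False
      then have "act (- a) (s # a # w) = (s - 1) # w" by (simp add: act_def)
      moreover obtain u where "set u \<subseteq> letters" "hd (acts u ((s - 1) # w)) \<le> 1"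
        using Cons.IH[of "s - 1"] Cons.prems by (auto simp: reduced_Cons)
      ultimately show ?thesis
        using Cons.prems by (intro exI[of _ "u @ [- a]"]) (auto simp: reduced_Cons)
    qed
  qed
  moreover have "s \<le> length w" using p by linarith
  ultimately show ?thesis using p by blast
qed

lemma acts_funpow: "(acts u ^^ n) p = acts (concat (replicate n u)) p"
  by (induction n) auto

text \<open>A reduced word is conjugate to a cyclically reduced one, whose powers are reduced.\<close>

lemma acts_power_neq_id:
  assumes "reduced_word w" "w \<noteq> []" "n > 0"
  shows "\<exists>p\<in>tree. (acts w ^^ n) p \<noteq> p"
  using assms(1,2)
proof (induction "length w" arbitrary: w rule: less_induct)
  case (less w)
  show ?case
  proof (cases "hd w = - last w")
    case False
    \<comment> \<open>Here \<open>w\<close> is cyclically reduced: no cancellation occurs where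
      copies meet, so a power is a nonempty reduced word and moves the root.\<close>
    have "reduced_word (concat (replicate k w)) \<and> (k > 0 \<longrightarrow> concat (replicate k w) \<noteq> [] \<and> hd (concat (replicate k w)) = hd w)" for k
      by (induction k) (use less.prems False in \<open>auto simp: reduced_append\<close>)
    from this[of n] have "(acts w ^^ n) [0] \<noteq> [0]"
      using assms(3) by (simp add: acts_funpow acts_root del: length_concat)
    then show ?thesis by force
  next
    case True
    obtain x v where w: "w = x # v" using less.prems by (cases w) auto
    have x: "x \<in> letters" using less.prems w by (simp add: reduced_Cons)
    have "v \<noteq> []" using True w letter_neq_neg[OF x] by auto
    then obtain y where v: "v = y @ [- x]" using True w by (metis append_butlast_last_id equation_minus_iff last_ConsR list.sel(1))
    \<comment> \<open>Otherwise \<open>x\<close> and \<open>- x\<close> would be adjacent in the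
      reduced word \<open>w\<close>.\<close>
    have "y \<noteq> []" using less.prems w v by (auto simp: reduced_Cons)
    moreover have "reduced_word y" using less.prems w v by (auto simp: reduced_Cons reduced_append)
    moreover have "length y < length w" using w v by simp
    ultimately obtain p where p: "p \<in> tree" "(acts y ^^ n) p \<noteq> p" using less.hyps by blast
    have y: "set y \<subseteq> letters" using \<open>reduced_word y\<close> by (simp add: reduced_word_def)
    have in_tree: "(acts y ^^ k) p \<in> tree" for k
      by (induction k) (use p y in \<open>auto simp: acts_in_tree\<close>)
    have conj: "(acts w ^^ k) (act x p) = act x ((acts y ^^ k) p)" for k
    proof (induction k)
      case (Suc k)
      have "act (- x) (act x ((acts y ^^ k) p)) = (acts y ^^ k) p"
        using act_act_neg[OF in_tree, of "- x"] x by simp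
      then show ?case using Suc w v by simp
    qed simp
    have "act x ((acts y ^^ n) p) \<noteq> act x p"
      using p act_act_neg[OF in_tree, of "- x"] act_act_neg[OF p(1), of "- x"] x
      by (metis minus_minus neg_letter)
    then show ?thesis using conj[of n] act_in_tree[OF p(1) x] by force
  qed
qed

section \<open>The axis of the generator \<open>1\<close>\<close>

definition axis :: "real \<Rightarrow> real list" where
  "axis t = (if t \<ge> 0 then tpath (replicate (nat \<lceil>t\<rceil>) 1) t else tpath (replicate (nat \<lceil>- t\<rceil>) (- 1)) (- t))"

lemma axis_eq: "axis t = \<bar>t\<bar> # replicate (nat \<lceil>\<bar>t\<bar>\<rceil>) (if t \<ge> 0 then 1 else - 1)"
  by (auto simp: axis_def tpath_def)

lemma axis_in_tree: "axis t \<in> tree"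
  by (auto simp: axis_eq Cons_in_tree intro!: reduced_replicate simp: letters_def)

lemma lcp_replicate: "lcp (replicate m a) (replicate n b) = (if a = b then min m n else 0)"
proof (induction m arbitrary: n)
  case (Suc m)
  then show ?case by (cases n) auto
qed simp

lemma axis_isometry: "tdist (axis s) (axis t) = \<bar>s - t\<bar>"
proof -
  define m n where "m = nat \<lceil>\<bar>s\<bar>\<rceil>" and "n = nat \<lceil>\<bar>t\<bar>\<rceil>"
  have mn: "\<bar>s\<bar> \<le> real m" "\<bar>t\<bar> \<le> real n" unfolding m_def n_def by linarith+
  have "meet (axis s) (axis t) = min (min \<bar>s\<bar> \<bar>t\<bar>) (real (if (s \<ge> 0) = (t \<ge> 0) then min m n else 0))"
    unfolding meet_def axis_eq m_def[symmetric] n_def[symmetric] by (simp add: lcp_replicate)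
  also have "\<dots> = (if (s \<ge> 0) = (t \<ge> 0) then min \<bar>s\<bar> \<bar>t\<bar> else 0)" using mn by (auto simp: min_def)
  finally have "meet (axis s) (axis t) = \<dots>" .
  moreover have "hd (axis s) = \<bar>s\<bar>" "hd (axis t) = \<bar>t\<bar>" by (simp_all add: axis_eq)
  ultimately show ?thesis unfolding tdist_def by (auto simp: min_def)
qed

text \<open>The translation length 1 matches the time-one flow, so on lines over the axis the flow
  can be undone by a group element.\<close>

lemma act_axis: "act 1 (axis t) = axis (t + 1)"
proof -
  consider "t \<ge> 0" | "t \<le> -1" | "-1 < t" "t < 0" by linarith
  then show ?thesis
  proof cases
    case 1
    have "nat \<lceil>t + 1\<rceil> = Suc (nat \<lceil>t\<rceil>)" using 1 by linarith
    moreover have "replicate (nat \<lceil>t\<rceil>) (1::real) \<noteq> [] \<longrightarrow> hd (replicate (nat \<lceil>t\<rceil>) (1::real)) = 1"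
      by (cases "nat \<lceil>t\<rceil>") auto
    ultimately show ?thesis using 1 by (auto simp: axis_eq act_def)
  next
    case 2
    have "nat \<lceil>- t\<rceil> = Suc (nat \<lceil>- t - 1\<rceil>)" using 2 by linarith
    then show ?thesis using 2 by (cases "t = -1") (auto simp: axis_eq act_def)
  next
    \<comment> \<open>The point lies inside the edge that \<open>act\<close> flips.\<close>
    case 3
    have "nat \<lceil>- t\<rceil> = 1" "nat \<lceil>t + 1\<rceil> = 1" using 3 by linarith+
    then show ?thesis using 3 by (simp add: axis_eq act_def)
  qed
qed

section \<open>The tree times an interval\<close>

text \<open>The interval coordinate is put in front of the code of a tree point, so that points of
  the product are again lists of reals.\<close>

definition slab :: "real list set" where
  "slab = {h # p | h p. 0 \<le> h \<and> h \<le> 1 \<and> p \<in> tree}"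

definition sdist :: "real list \<Rightarrow> real list \<Rightarrow> real" where
  "sdist x y = max \<bar>hd x - hd y\<bar> (tdist (tl x) (tl y))"

text \<open>Restricted to \<open>slab\<close> because elements of \<open>isom_group\<close> are
  extensional functions.\<close>

definition word_isom :: "real list \<Rightarrow> real list \<Rightarrow> real list" where
  "word_isom u = (\<lambda>x\<in>slab. hd x # acts u (tl x))"

definition word_group :: "(real list \<Rightarrow> real list) set" where
  "word_group = {word_isom u | u. set u \<subseteq> letters}"

lemma slabD: "x \<in> slab \<Longrightarrow> 0 \<le> hd x" "x \<in> slab \<Longrightarrow> hd x \<le> 1" "x \<in> slab \<Longrightarrow> tl x \<in> tree"
  "x \<in> slab \<Longrightarrow> hd x # tl x = x"
  by (auto simp: slab_def)

lemma Cons_in_slab: "h # p \<in> slab \<longleftrightarrow> 0 \<le> h \<and> h \<le> 1 \<and> p \<in> tree"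
  by (auto simp: slab_def)

lemma base_in_slab [simp]: "[0, 0] \<in> slab"
  by (simp add: Cons_in_slab)

lemma sdist_Cons: "sdist (h # p) (k # q) = max \<bar>h - k\<bar> (tdist p q)"
  by (simp add: sdist_def)

lemma sdist_bounds:
  assumes "x \<in> slab" "y \<in> slab"
  shows "tdist (tl x) (tl y) \<le> sdist x y" "sdist x y \<le> tdist (tl x) (tl y) + 1"
  using slabD[OF assms(1)] slabD[OF assms(2)] tdist_nonneg[of "tl x" "tl y"]
  by (auto simp: sdist_def)

interpretation slab: Metric_space slab sdist
proof
  show "0 \<le> sdist x y" for x y by (simp add: sdist_def le_max_iff_disj)
  show "sdist x y = sdist y x" for x y by (simp add: sdist_def abs_minus_commute tdist_commute)
  show "sdist x y = 0 \<longleftrightarrow> x = y" if "x \<in> slab" "y \<in> slab" for x y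
  proof
    assume "sdist x y = 0"
    then have "\<bar>hd x - hd y\<bar> \<le> 0" "tdist (tl x) (tl y) \<le> 0"
      by (metis sdist_def max.cobounded1, metis sdist_def max.cobounded2)
    then have "hd x = hd y" "tl x = tl y"
      using that tdist_nonneg[of "tl x" "tl y"] by (auto intro!: tdist_eq_0 simp: slabD)
    then show "x = y" using slabD(4) that by metis
  next
    assume "x = y"
    then show "sdist x y = 0" using that by (simp add: sdist_def tdist_self slabD)
  qed
  show "sdist x z \<le> sdist x y + sdist y z" for x y z
    using tdist_triangle[of "tl x" "tl z" "tl y"] by (auto simp: sdist_def)
qed

lemma sdist_base: "x \<in> slab \<Longrightarrow> sdist [0, 0] x = max (hd x) (hd (tl x))"
  by (simp add: sdist_def tdist_root slabD)

text \<open>Over a single path from the root the coding preserves distances for the maximum metric,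
  so it is continuous on a compact rectangle.\<close>

lemma compactin_chart:
  assumes "reduced_word w"
  shows "compactin slab.mtopology ((\<lambda>(h, s). h # tpath w s) ` ({0..1::real} \<times> {0..real (length w)}))"
proof -
  let ?B = "{0..1::real} \<times> {0..real (length w)}"
  let ?f = "\<lambda>(h, s). h # tpath w s"
  have "continuous_map (top_of_set ?B) slab.mtopology ?f"
    unfolding slab.continuous_map_to_metric
  proof (intro ballI allI impI)
    fix x and \<epsilon> :: real assume x: "x \<in> topspace (top_of_set ?B)" and \<epsilon>: "0 < \<epsilon>"
    have "?f y \<in> slab.mball (?f x) \<epsilon>" if y: "y \<in> ?B \<inter> ball x \<epsilon>" for y
    proof -
      obtain h s k t where xy: "x = (h, s)" "y = (k, t)" by (cases x; cases y)
      have "\<bar>h - k\<bar> < \<epsilon>" "\<bar>s - t\<bar> < \<epsilon>"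
        using y dist_fst_le[of x y] dist_snd_le[of x y] xy by (auto simp: dist_real_def)
      moreover have "tdist (tpath w s) (tpath w t) = \<bar>s - t\<bar>"
        using x y xy by (intro tdist_path) auto
      ultimately show ?thesis
        using x y xy tpath_in_tree[OF assms] by (auto simp: sdist_Cons Cons_in_slab)
    qed
    moreover have "openin (top_of_set ?B) (?B \<inter> ball x \<epsilon>)" by (intro openin_open_Int) auto
    moreover have "x \<in> ?B \<inter> ball x \<epsilon>" using x \<epsilon> by simp
    ultimately show "\<exists>U. openin (top_of_set ?B) U \<and> x \<in> U \<and> (\<forall>y\<in>U. ?f y \<in> slab.mball (?f x) \<epsilon>)"
      by blast
  qed
  moreover have "compactin (top_of_set ?B) ?B"
    by (simp add: compactin_subtopology compact_Times)
  ultimately show ?thesis by (intro image_compactin)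
qed

text \<open>A bounded ball reaches only words of bounded length, and the charts of these finitely
  many words cover it.\<close>

lemma proper_slab: "proper_metric slab sdist"
  unfolding proper_metric_def
proof (intro ballI allI)
  fix x r assume x: "x \<in> slab"
  define n where "n = nat \<lceil>sdist [0, 0] x + r\<rceil>"
  let ?W = "{w. reduced_word w \<and> length w \<le> n}"
  let ?c = "\<lambda>w. (\<lambda>(h, s). h # tpath w s) ` ({0..1::real} \<times> {0..real (length w)})"
  have "finite ?W"
    by (rule finite_subset[OF _ finite_lists_length_le[OF finite_letters, of n]])
      (auto simp: reduced_word_def)
  then have "compactin slab.mtopology (\<Union> (?c ` ?W))"
    by (intro compactin_Union) (auto intro: compactin_chart)
  moreover have "slab.mcball x r \<subseteq> \<Union> (?c ` ?W)"
  proof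
    fix y assume y: "y \<in> slab.mcball x r"
    then have "sdist [0, 0] y \<le> sdist [0, 0] x + r"
      using slab.triangle[of "[0, 0]" x y] by simp
    then have hy: "hd (tl y) \<le> sdist [0, 0] x + r" using y sdist_base[of y] by simp
    obtain s w where w: "tl y = s # w" "reduced_word w" "0 \<le> s" "length w = nat \<lceil>s\<rceil>"
      using slabD(3)[of y] y by (auto elim: treeE)
    have "length w \<le> n" using hy w nat_mono[OF ceiling_mono[of s "sdist [0, 0] x + r"]] by (simp add: n_def)
    moreover have "y = hd y # tpath w s" using tpath_tree[of s w] w y slabD(3,4)[of y] by simp
    moreover have "s \<le> real (length w)" using w by linarith
    ultimately show "y \<in> \<Union> (?c ` ?W)" using w y slabD(1,2)[of y]
      by (intro UN_I[of w] image_eqI[of _ _ "(hd y, s)"]) auto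
  qed
  ultimately show "compactin slab.mtopology (slab.mcball x r)"
    using closed_compactin slab.closedin_mcball by blast
qed

text \<open>Both coordinates run at constant speed during time \<open>D\<close>. The larger of the
  two displacements is \<open>D\<close>, so one coordinate has speed 1 and the other at most
  1.\<close>

lemma geodesic_slab: "geodesic_metric slab sdist"
  unfolding geodesic_metric_def
proof (intro ballI)
  fix x y assume x: "x \<in> slab" and y: "y \<in> slab"
  define D where "D = sdist x y"
  define \<tau> where "\<tau> = tdist (tl x) (tl y)"
  show "\<exists>c. c ` {0..sdist x y} \<subseteq> slab \<and> c 0 = x \<and> c (sdist x y) = y \<and>
      (\<forall>s\<in>{0..sdist x y}. \<forall>t\<in>{0..sdist x y}. sdist (c s) (c t) = \<bar>s - t\<bar>)"
  proof (cases "x = y")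
    case True
    then show ?thesis using x by (intro exI[of _ "\<lambda>_. x"]) auto
  next
    case False
    then have D: "D > 0" unfolding D_def using x y by simp
    have \<tau>: "0 \<le> \<tau>" "\<tau> \<le> D" unfolding \<tau>_def D_def by (simp_all add: tdist_nonneg sdist_def)
    obtain c where c: "c ` {0..\<tau>} \<subseteq> tree" "c 0 = tl x" "c \<tau> = tl y"
        "\<And>s t. s \<in> {0..\<tau>} \<Longrightarrow> t \<in> {0..\<tau>} \<Longrightarrow> tdist (c s) (c t) = \<bar>s - t\<bar>"
      using tree_geodesic[OF slabD(3)[OF x] slabD(3)[OF y]] unfolding \<tau>_def by metis
    define e where "e s = (hd x + (hd y - hd x) * (s / D)) # c (\<tau> * (s / D))" for s
    have unit: "0 \<le> s / D" "s / D \<le> 1" if "s \<in> {0..D}" for s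
      using that D by simp_all
    have in\<tau>: "\<tau> * (s / D) \<in> {0..\<tau>}" if "s \<in> {0..D}" for s
      unfolding atLeastAtMost_iff using unit[OF that] \<tau>
      by (intro conjI mult_nonneg_nonneg mult_left_le)
    have "e s \<in> slab" if s: "s \<in> {0..D}" for s
    proof -
      have "hd x + (hd y - hd x) * (s / D) = (1 - s / D) * hd x + (s / D) * hd y"
        by (simp add: algebra_simps)
      moreover have "0 \<le> \<dots>" using unit[OF s] slabD(1)[OF x] slabD(1)[OF y]
        by (intro add_nonneg_nonneg mult_nonneg_nonneg) simp_all
      moreover have "(1 - s / D) * hd x + (s / D) * hd y \<le> (1 - s / D) * 1 + (s / D) * 1"
        using unit[OF s] slabD[OF x] slabD[OF y] by (intro add_mono mult_left_mono) auto
      ultimately show ?thesis using in\<tau>[OF s] c(1) by (auto simp: e_def Cons_in_slab)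
    qed
    moreover have "e 0 = x" using c(2) slabD(4)[OF x] by (simp add: e_def)
    moreover have "e D = y" using c(3) slabD(4)[OF y] D by (simp add: e_def)
    moreover have "sdist (e s) (e t) = \<bar>s - t\<bar>" if s: "s \<in> {0..D}" and t: "t \<in> {0..D}" for s t
    proof -
      have "sdist (e s) (e t) =
          max \<bar>(hd y - hd x) * (s / D) - (hd y - hd x) * (t / D)\<bar> \<bar>\<tau> * (s / D) - \<tau> * (t / D)\<bar>"
        unfolding e_def sdist_Cons c(4)[OF in\<tau>[OF s] in\<tau>[OF t]] by simp
      also have "(hd y - hd x) * (s / D) - (hd y - hd x) * (t / D) = (hd y - hd x) * ((s - t) / D)"
        by (simp add: diff_divide_distrib right_diff_distrib)
      also have "\<tau> * (s / D) - \<tau> * (t / D) = \<tau> * ((s - t) / D)"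
        by (simp add: diff_divide_distrib right_diff_distrib)
      also have "max \<bar>(hd y - hd x) * ((s - t) / D)\<bar> \<bar>\<tau> * ((s - t) / D)\<bar> =
          max \<bar>hd y - hd x\<bar> \<tau> * (\<bar>s - t\<bar> / D)"
        using \<tau> D by (simp add: abs_mult max_mult_distrib_right del: times_divide_eq_right)
      also have "max \<bar>hd y - hd x\<bar> \<tau> = D" by (simp add: D_def \<tau>_def sdist_def abs_minus_commute)
      finally show ?thesis using D by simp
    qed
    ultimately show ?thesis unfolding D_def[symmetric] by (intro exI[of _ e]) auto
  qed
qed

text \<open>In the tree the heights cancel and the inequality at base point \<open>w\<close> becomes
  \<open>meet_four_points\<close>, with constant 0. Each Gromov product of the slab is within 1 of
  that of the tree; an error of 1 on either side gives 2.\<close>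

lemma hyperbolic_slab: "gromov_hyperbolic slab sdist"
  unfolding gromov_hyperbolic_def
proof (intro exI[of _ 2] conjI ballI)
  fix x y z w assume xyzw: "x \<in> slab" "y \<in> slab" "z \<in> slab" "w \<in> slab"
  define P where "P a b = (tdist (tl w) (tl a) + tdist (tl w) (tl b) - tdist (tl a) (tl b)) / 2" for a b
  have near: "\<bar>gromov_product sdist w a b - P a b\<bar> \<le> 1" if "a \<in> slab" "b \<in> slab" for a b
    using sdist_bounds[OF xyzw(4) that(1)] sdist_bounds[OF xyzw(4) that(2)] sdist_bounds[OF that]
    by (simp add: P_def gromov_product_def abs_le_iff field_simps)
  have "min (P x y) (P y z) \<le> P x z"
    using meet_four_points[of "tl x" "tl y" "tl z" "tl w"]
      meet_commute[of "tl w" "tl x"] meet_commute[of "tl w" "tl y"] meet_commute[of "tl w" "tl z"]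
    by (auto simp: P_def tdist_def min_def split: if_splits)
  then show "min (gromov_product sdist w x y) (gromov_product sdist w y z) - 2 \<le> gromov_product sdist w x z"
    using near[OF xyzw(1,2)] near[OF xyzw(2,3)] near[OF xyzw(1,3)] by (auto simp: min_def split: if_splits)
qed simp

section \<open>The free group of isometries\<close>

lemma word_isom_apply: "x \<in> slab \<Longrightarrow> word_isom u x = hd x # acts u (tl x)"
  by (simp add: word_isom_def)

lemma word_isom_in_slab: "set u \<subseteq> letters \<Longrightarrow> x \<in> slab \<Longrightarrow> word_isom u x \<in> slab"
  by (simp add: word_isom_apply Cons_in_slab slabD acts_in_tree)

lemma sdist_word_isom:
  "set u \<subseteq> letters \<Longrightarrow> x \<in> slab \<Longrightarrow> y \<in> slab \<Longrightarrow> sdist (word_isom u x) (word_isom u y) = sdist x y"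
  by (simp add: word_isom_apply sdist_def acts_isometry slabD)

lemma word_isom_append:
  "set v \<subseteq> letters \<Longrightarrow> compose slab (word_isom u) (word_isom v) = word_isom (u @ v)"
  by (rule ext) (auto simp: compose_def word_isom_def Cons_in_slab slabD acts_in_tree)

lemma word_isom_Nil: "word_isom [] = (\<lambda>x\<in>slab. x)"
  by (rule ext) (simp add: word_isom_def slabD(4))

lemma word_isom_cong: "(\<And>p. p \<in> tree \<Longrightarrow> acts u p = acts v p) \<Longrightarrow> word_isom u = word_isom v"
  by (auto simp: word_isom_def slabD)

lemma word_isom_inverse:
  assumes "set u \<subseteq> letters"
  shows "compose slab (word_isom (inverse_word u)) (word_isom u) = (\<lambda>x\<in>slab. x)"
    "compose slab (word_isom u) (word_isom (inverse_word u)) = (\<lambda>x\<in>slab. x)"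
  using assms acts_inverse_word[OF assms] acts_inverse_word'[OF assms]
  by (simp_all add: word_isom_append inverse_word_letters word_isom_Nil[symmetric] cong: word_isom_cong)
    (auto intro!: word_isom_cong)

lemma word_isom_in_isom_group:
  assumes u: "set u \<subseteq> letters"
  shows "word_isom u \<in> carrier (isom_group slab sdist)"
proof -
  have inv: "word_isom (inverse_word u) (word_isom u x) = x" "word_isom u (word_isom (inverse_word u) x) = x"
    if "x \<in> slab" for x
    using fun_cong[OF word_isom_inverse(1)[OF u], of x] fun_cong[OF word_isom_inverse(2)[OF u], of x] that
    by (simp_all add: compose_eq)
  have "bij_betw (word_isom u) slab slab"
    using inv word_isom_in_slab[OF u] word_isom_in_slab[OF inverse_word_letters[OF u]]
    by (intro bij_betw_byWitness[of _ "word_isom (inverse_word u)"]) auto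
  moreover have "word_isom u \<in> extensional slab" by (simp add: word_isom_def)
  ultimately show ?thesis using sdist_word_isom[OF u] by (simp add: isom_group_def Bij_def)
qed

lemma isom_group_mult:
  "g \<in> carrier (isom_group M d) \<Longrightarrow> h \<in> carrier (isom_group M d) \<Longrightarrow>
    g \<otimes>\<^bsub>isom_group M d\<^esub> h = compose M g h"
  by (simp add: isom_group_def BijGroup_def)

lemma isom_group_one: "\<one>\<^bsub>isom_group M d\<^esub> = (\<lambda>x\<in>M. x)"
  by (simp add: isom_group_def BijGroup_def)

lemma subgroup_word_group: "subgroup word_group (isom_group slab sdist)"
proof -
  interpret I: group "isom_group slab sdist" by (rule group_isom_group)
  show ?thesis
  proof (rule I.subgroupI)
    show "word_group \<subseteq> carrier (isom_group slab sdist)"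
      using word_isom_in_isom_group by (auto simp: word_group_def)
    have "word_isom [] \<in> word_group" unfolding word_group_def by (intro CollectI exI[of _ "[]"]) simp
    then show "word_group \<noteq> {}" by blast
  next
    fix g assume "g \<in> word_group"
    then obtain u where u: "g = word_isom u" "set u \<subseteq> letters" by (auto simp: word_group_def)
    have "inv\<^bsub>isom_group slab sdist\<^esub> g = word_isom (inverse_word u)"
      using word_isom_in_isom_group[OF u(2)] word_isom_in_isom_group[OF inverse_word_letters[OF u(2)]]
      by (intro I.inv_equality) (simp_all add: u isom_group_mult isom_group_one word_isom_inverse)
    then show "inv\<^bsub>isom_group slab sdist\<^esub> g \<in> word_group"
      using inverse_word_letters[OF u(2)] by (auto simp: word_group_def)
  next
    fix g h assume "g \<in> word_group" "h \<in> word_group"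
    then obtain u v where uv: "g = word_isom u" "set u \<subseteq> letters" "h = word_isom v" "set v \<subseteq> letters"
      by (auto simp: word_group_def)
    then have "g \<otimes>\<^bsub>isom_group slab sdist\<^esub> h = word_isom (u @ v)"
      by (simp add: isom_group_mult word_isom_in_isom_group word_isom_append)
    moreover have "set (u @ v) \<subseteq> letters" using uv by simp
    ultimately show "g \<otimes>\<^bsub>isom_group slab sdist\<^esub> h \<in> word_group"
      unfolding word_group_def by blast
  qed
qed

interpretation slab: isom_action slab sdist word_group
  by (intro isom_action.intro isom_action_axioms.intro slab.Metric_space_axioms subgroup_word_group)

section \<open>Growth, torsion and limit points of the group\<close>

lemma word_groupE:
  assumes "g \<in> word_group"
  obtains w where "g = word_isom w" "reduced_word w" "set w \<subseteq> letters"
proof -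
  obtain u where u: "g = word_isom u" "set u \<subseteq> letters" using assms by (auto simp: word_group_def)
  obtain w where w: "reduced_word w" "\<forall>p\<in>tree. acts w p = acts u p" using exists_reduced[OF u(2)] by blast
  show thesis
  proof
    show "g = word_isom w" unfolding u using w(2) by (intro word_isom_cong) simp
    show "reduced_word w" by (rule w)
    then show "set w \<subseteq> letters" by (simp add: reduced_word_def)
  qed
qed

lemma word_isom_in_group: "set u \<subseteq> letters \<Longrightarrow> word_isom u \<in> word_group"
  by (auto simp: word_group_def)

lemma word_isom_base: "reduced_word w \<Longrightarrow> word_isom w [0, 0] = 0 # real (length w) # w"
  by (simp add: word_isom_apply acts_root)

lemma sdist_base_word_isom:
  assumes "reduced_word w"
  shows "sdist [0, 0] (word_isom w [0, 0]) = real (length w)"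
proof -
  have "word_isom w [0, 0] \<in> slab" using assms by (intro word_isom_in_slab) (auto simp: reduced_word_def)
  then show ?thesis by (simp add: sdist_base word_isom_base[OF assms])
qed

lemma cobounded_slab:
  assumes "x \<in> slab"
  shows "\<exists>g\<in>word_group. sdist [0, 0] (g x) \<le> 1"
proof -
  obtain u where u: "set u \<subseteq> letters" "hd (acts u (tl x)) \<le> 1"
    using acts_to_root[OF slabD(3)[OF assms]] by blast
  have "sdist [0, 0] (word_isom u x) \<le> 1"
    using u slabD[OF assms] word_isom_in_slab[OF u(1) assms]
    by (simp add: sdist_base) (simp add: word_isom_apply assms)
  then show ?thesis using word_isom_in_group[OF u(1)] by blast
qed

lemma sum_powers_le: "(\<Sum>i\<le>n. 4 ^ i) \<le> (4::nat) ^ (n + 1)"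
  by (induction n) auto

text \<open>The displacement of the base point is the reduced word length. Counting all words in
  four letters, reduced or not, is crude but sufficient, since the entropy will exceed any
  bound.\<close>

lemma word_group_growth:
  "finite {g \<in> word_group. sdist [0, 0] (g [0, 0]) \<le> real n}"
  "card {g \<in> word_group. sdist [0, 0] (g [0, 0]) \<le> real n} \<le> 4 ^ (n + 1)"
proof -
  let ?L = "{w. set w \<subseteq> letters \<and> length w \<le> n}"
  have sub: "{g \<in> word_group. sdist [0, 0] (g [0, 0]) \<le> real n} \<subseteq> word_isom ` ?L"
    by (auto elim!: word_groupE simp: sdist_base_word_isom)
  have fin: "finite ?L" by (rule finite_lists_length_le[OF finite_letters])
  then show "finite {g \<in> word_group. sdist [0, 0] (g [0, 0]) \<le> real n}"
    using sub finite_subset by blast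
  have "card {g \<in> word_group. sdist [0, 0] (g [0, 0]) \<le> real n} \<le> card ?L"
    using sub fin by (meson card_image_le card_mono finite_imageI order_trans)
  also have "\<dots> = (\<Sum>i\<le>n. 4 ^ i)"
    by (simp add: card_lists_length_le[OF finite_letters] card_letters)
  finally show "card {g \<in> word_group. sdist [0, 0] (g [0, 0]) \<le> real n} \<le> 4 ^ (n + 1)"
    using sum_powers_le[of n] by simp
qed

text \<open>Represented by a reduced word, a nontrivial element has a power moving some tree point
  by \<open>acts_power_neq_id\<close>, hence also the point of the slab above it at height
  0.\<close>

lemma torsion_free_word_group: "torsion_free (isom_subgroup slab sdist word_group)"
  unfolding torsion_free_def
proof (intro ballI allI impI, elim conjE)
  let ?G = "isom_subgroup slab sdist word_group"
  interpret G: group ?G by (rule subgroup.subgroup_is_group[OF subgroup_word_group group_isom_group])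
  fix g and n :: nat
  assume "g \<in> carrier ?G" and n: "n > 0" "g [^]\<^bsub>?G\<^esub> n = \<one>\<^bsub>?G\<^esub>"
  then obtain w where w: "g = word_isom w" "reduced_word w" "set w \<subseteq> letters"
    by (auto elim: word_groupE)
  have g: "g \<in> word_group" using w word_isom_in_group by simp
  have mem: "h \<in> carrier (isom_group slab sdist)" if "h \<in> word_group" for h
    using that subgroup.subset[OF subgroup_word_group] by blast
  have pow: "(g [^]\<^bsub>?G\<^esub> k) x = hd x # (acts w ^^ k) (tl x)" if "x \<in> slab" for k x
    using that
  proof (induction k arbitrary: x)
    case 0
    then show ?case by (simp add: isom_group_one slabD)
  next
    case (Suc k)
    have "g [^]\<^bsub>?G\<^esub> k \<in> word_group" using G.nat_pow_closed[of g k] g by simp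
    then have "g [^]\<^bsub>?G\<^esub> Suc k = compose slab (g [^]\<^bsub>?G\<^esub> k) g"
      using g mem by (simp add: isom_group_mult)
    then show ?case
      using Suc word_isom_in_slab[OF w(3) Suc.prems]
      by (simp add: compose_eq w word_isom_apply funpow_swap1)
  qed
  have "w = []"
  proof (rule ccontr)
    assume "w \<noteq> []"
    then obtain p where p: "p \<in> tree" "(acts w ^^ n) p \<noteq> p" using acts_power_neq_id w(2) n(1) by blast
    then show False using pow[of "0 # p" n] n(2) by (simp add: Cons_in_slab isom_group_one)
  qed
  then show "g = \<one>\<^bsub>?G\<^esub>" using w by (simp add: word_isom_Nil isom_group_one)
qed

text \<open>Rays spelled by different letters part at the root, while powers of one letter lie on a
  common ray.\<close>

lemma gromov_product_letter_powers:
  assumes "a \<in> letters" "b \<in> letters"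
  shows "gromov_product sdist [0, 0] (word_isom (replicate m a) [0, 0]) (word_isom (replicate n b) [0, 0]) =
    (if a = b then real (min m n) else 0)"
proof -
  have "0 \<le> tdist (real m # replicate m a) (real n # replicate n b)" by (rule tdist_nonneg)
  then have "sdist (word_isom (replicate m a) [0, 0]) (word_isom (replicate n b) [0, 0]) =
      real m + real n - 2 * (if a = b then real (min m n) else 0)"
    using reduced_replicate[OF assms(1)] reduced_replicate[OF assms(2)]
    by (auto simp: word_isom_base sdist_Cons tdist_def meet_def lcp_replicate max_def min_def)
  then show ?thesis
    using sdist_base_word_isom[OF reduced_replicate[OF assms(1)], of m]
      sdist_base_word_isom[OF reduced_replicate[OF assms(2)], of n]
    by (simp add: gromov_product_def)
qed

text \<open>The powers of the letters 1, -1 and 2, applied to \<open>x\<close>, run to three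
  different boundary points, one more than an elementary group can have.\<close>

lemma non_elementary_word_group: "non_elementary slab sdist word_group"
  unfolding non_elementary_def
proof (intro ballI notI, elim conjE)
  fix x assume x: "x \<in> slab"
  assume fin: "finite (limit_set slab sdist word_group x)" and small: "card (limit_set slab sdist word_group x) \<le> 2"
  let ?R = "{(s, s'). s \<in> gromov_sequences slab sdist \<and> s' \<in> gromov_sequences slab sdist \<and>
    gromov_asymptotic slab sdist s s'}"
  define s where "s a n = word_isom (replicate n a) x" for a :: real and n :: nat
  define z where "z a = ?R `` {s a}" for a
  let ?o = "[0, 0] :: real list"
  have grp: "word_isom (replicate n a) \<in> word_group" if "a \<in> letters" for n a
    using that by (intro word_isom_in_group) auto
  have coarse: "\<bar>gromov_product sdist w (s a m) (s b n) - (if a = b then real (min m n) else 0)\<bar>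
      \<le> 2 * sdist ?o x + sdist ?o w" if "a \<in> letters" "b \<in> letters" "w \<in> slab" for a b m n w
    using slab.gromov_product_orbit_coarse[OF grp[OF that(1)] grp[OF that(2)] base_in_slab x that(3), of m n]
    unfolding s_def gromov_product_letter_powers[OF that(1,2)] .
  have asym: "gromov_asymptotic slab sdist (s a) (s a)" if a: "a \<in> letters" for a
    unfolding gromov_asymptotic_def filterlim_at_top eventually_prod_sequentially
  proof (intro ballI allI)
    fix w Z assume w: "w \<in> slab"
    show "\<exists>N. \<forall>m\<ge>N. \<forall>n\<ge>N. Z \<le> (case (n, m) of (m, n) \<Rightarrow> gromov_product sdist w (s a m) (s a n))"
    proof (intro exI[of _ "nat \<lceil>Z + (2 * sdist ?o x + sdist ?o w)\<rceil>"] allI impI)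
      fix m n assume "nat \<lceil>Z + (2 * sdist ?o x + sdist ?o w)\<rceil> \<le> m" "nat \<lceil>Z + (2 * sdist ?o x + sdist ?o w)\<rceil> \<le> n"
      then have "Z + (2 * sdist ?o x + sdist ?o w) \<le> real (min n m)" by linarith
      then show "Z \<le> (case (n, m) of (m, n) \<Rightarrow> gromov_product sdist w (s a m) (s a n))"
        using coarse[OF a a w, of n m] by simp
    qed
  qed
  have seq: "s a \<in> gromov_sequences slab sdist" if "a \<in> letters" for a
    using asym[OF that] word_isom_in_slab[OF _ x] that
    by (auto simp: gromov_sequences_def s_def in_set_replicate intro!: word_isom_in_slab[OF _ x])
  have "z a \<in> limit_set slab sdist word_group x" if a: "a \<in> letters" for a
  proof -
    have "s a \<in> z a" using asym[OF a] seq[OF a] by (simp add: z_def)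
    moreover have "range (s a) \<subseteq> isom_orbit slab sdist word_group x"
      using grp[OF a] by (auto simp: s_def orbit_def)
    moreover have "z a \<in> gromov_boundary slab sdist"
      unfolding gromov_boundary_def z_def by (rule quotientI[OF seq[OF a]])
    ultimately show ?thesis by (auto simp: limit_set_def)
  qed
  then have sub: "z ` {1, - 1, 2} \<subseteq> limit_set slab sdist word_group x"
    by (auto simp: letters_def)
  have "inj_on z {1, - 1, 2}"
  proof (rule inj_onI, rule ccontr)
    fix a b assume "a \<in> {1, - 1, 2}" "b \<in> {1, - 1, 2}" and eq: "z a = z b" "a \<noteq> b"
    then have ab: "a \<in> letters" "b \<in> letters" by (auto simp: letters_def)
    have "s b \<in> z a" using asym[OF ab(2)] seq[OF ab(2)] eq by (simp add: z_def)
    then have "gromov_asymptotic slab sdist (s a) (s b)" by (simp add: z_def)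
    then have "filterlim (\<lambda>(m, n). gromov_product sdist ?o (s a m) (s b n)) at_top (sequentially \<times>\<^sub>F sequentially)"
      unfolding gromov_asymptotic_def using base_in_slab by blast
    \<comment> \<open>For different letters the exact product is 0, and at the base point itself the
      error in \<open>coarse\<close> is \<open>2 * sdist ?o x\<close>. Exceeding it by 1 is
      impossible.\<close>
    then have "\<exists>N. \<forall>m\<ge>N. \<forall>n\<ge>N. 2 * sdist ?o x + 1 \<le> gromov_product sdist ?o (s a n) (s b m)"
      unfolding filterlim_at_top eventually_prod_sequentially prod.case by (rule spec)
    then obtain N where "\<forall>m\<ge>N. \<forall>n\<ge>N. 2 * sdist ?o x + 1 \<le> gromov_product sdist ?o (s a n) (s b m)"
      by blast
    then have "2 * sdist ?o x + 1 \<le> gromov_product sdist ?o (s a N) (s b N)" by simp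
    then show False using coarse[OF ab base_in_slab, of N N] eq(2) by simp
  qed
  then have "card (z ` {1, - 1, 2}) = card {1, - 1, 2 :: real}" by (rule card_image)
  moreover have "card {1, - 1, 2 :: real} = 3" by simp
  ultimately have "3 \<le> card (limit_set slab sdist word_group x)" using card_mono[OF fin sub] by simp
  with small show False by simp
qed

section \<open>A full shift of geodesic lines\<close>

text \<open>All these lines project to the same line of the tree; in the second factor they are free to
  oscillate as long as they are 1-Lipschitz.\<close>

definition zigzag :: "nat \<Rightarrow> (int \<Rightarrow> nat) \<Rightarrow> real \<Rightarrow> real" where
  "zigzag N \<omega> t = real (\<omega> \<lfloor>t\<rfloor>) / real N * min (frac t) (1 - frac t)"

definition shift_line :: "nat \<Rightarrow> (int \<Rightarrow> nat) \<Rightarrow> real \<Rightarrow> real list" where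
  "shift_line N \<omega> t = zigzag N \<omega> t # axis t"

lemma zigzag_bounds:
  assumes "range \<omega> \<subseteq> {..<N}"
  shows "0 \<le> zigzag N \<omega> t" "zigzag N \<omega> t \<le> min (frac t) (1 - frac t)"
proof -
  define k where "k = real (\<omega> \<lfloor>t\<rfloor>) / real N"
  have "\<omega> \<lfloor>t\<rfloor> < N" using assms by auto
  then have "0 \<le> k" "k \<le> 1" by (auto simp: k_def)
  moreover have "0 \<le> min (frac t) (1 - frac t)" using frac_lt_1[of t] by simp
  ultimately show "0 \<le> zigzag N \<omega> t" "zigzag N \<omega> t \<le> min (frac t) (1 - frac t)"
    unfolding zigzag_def k_def[symmetric] by (simp_all only: mult_nonneg_nonneg mult_left_le_one_le)
qed

text \<open>Within one unit interval the function is a tent of slope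
  \<open>\<omega> / N < 1\<close>. If an integer separates \<open>s\<close> from \<open>t\<close>,
  both values lie between 0 and the distance to such an integer, hence in the interval from 0 to
  \<open>t - s\<close>, and so does the absolute value of their difference.\<close>

lemma zigzag_Lipschitz:
  assumes \<omega>: "range \<omega> \<subseteq> {..<N}"
  shows "\<bar>zigzag N \<omega> s - zigzag N \<omega> t\<bar> \<le> \<bar>s - t\<bar>"
proof -
  have *: "\<bar>zigzag N \<omega> s - zigzag N \<omega> t\<bar> \<le> t - s" if "s \<le> t" for s t
  proof (cases "\<lfloor>s\<rfloor> = \<lfloor>t\<rfloor>")
    case True
    define k where "k = real (\<omega> \<lfloor>t\<rfloor>) / real N"
    have "\<omega> \<lfloor>t\<rfloor> < N" using \<omega> by auto
    then have k: "0 \<le> k" "k \<le> 1" by (auto simp: k_def)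
    have "zigzag N \<omega> s - zigzag N \<omega> t = k * (min (frac s) (1 - frac s) - min (frac t) (1 - frac t))"
      by (simp add: zigzag_def k_def True right_diff_distrib)
    then have "\<bar>zigzag N \<omega> s - zigzag N \<omega> t\<bar> = k * \<bar>min (frac s) (1 - frac s) - min (frac t) (1 - frac t)\<bar>"
      using k by (simp add: abs_mult)
    also have "\<dots> \<le> \<bar>min (frac s) (1 - frac s) - min (frac t) (1 - frac t)\<bar>"
      using k by (intro mult_left_le_one_le) auto
    also have "\<dots> \<le> t - s" using that True by (auto simp: frac_def min_def)
    finally show ?thesis .
  next
    case False
    then have "\<lfloor>s\<rfloor> + 1 \<le> \<lfloor>t\<rfloor>" using that floor_mono[of s t] by linarith
    then have "real_of_int \<lfloor>s\<rfloor> + 1 \<le> real_of_int \<lfloor>t\<rfloor>" by linarith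
    then have "1 - frac s \<le> t - s" "frac t \<le> t - s"
      using floor_correct[of s] floor_correct[of t] unfolding frac_def by linarith+
    then show ?thesis
      using zigzag_bounds[OF \<omega>, of s] zigzag_bounds[OF \<omega>, of t] by (simp add: abs_le_iff)
  qed
  show ?thesis
    using *[of s t] *[of t s] by (cases "s \<le> t") (auto simp: abs_minus_commute)
qed

lemma zigzag_shift: "zigzag N \<omega> (t + 1) = zigzag N (\<lambda>k. \<omega> (k + 1)) t"
  by (simp add: zigzag_def frac_def)

lemma shift_line_in_lines:
  assumes "range \<omega> \<subseteq> {..<N}"
  shows "shift_line N \<omega> \<in> geodesic_lines slab sdist"
proof -
  have "shift_line N \<omega> t \<in> slab" for t
    using zigzag_bounds[OF assms, of t] frac_lt_1[of t] by (auto simp: shift_line_def Cons_in_slab axis_in_tree)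
  moreover have "sdist (shift_line N \<omega> s) (shift_line N \<omega> t) = \<bar>s - t\<bar>" for s t
    using zigzag_Lipschitz[OF assms, of s t] by (simp add: shift_line_def sdist_Cons axis_isometry)
  ultimately show ?thesis by (auto simp: geodesic_lines_def)
qed

text \<open>One unit of time moves the axis by the generator and makes the next symbol the current
  one. The generator is invisible in the quotient.\<close>

lemma geod_flow_shift_line:
  assumes "range \<omega> \<subseteq> {..<N}"
  shows "geod_flow 1 (shift_line N \<omega>) = word_isom [1] \<circ> shift_line N (\<lambda>k. \<omega> (k + 1))"
proof
  fix t
  have "range (\<lambda>k. \<omega> (k + 1)) \<subseteq> {..<N}" using assms by auto
  then have "shift_line N (\<lambda>k. \<omega> (k + 1)) t \<in> slab"
    using slab.lines_in_carrier shift_line_in_lines by blast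
  then show "geod_flow 1 (shift_line N \<omega>) t = (word_isom [1] \<circ> shift_line N (\<lambda>k. \<omega> (k + 1))) t"
    by (simp add: geod_flow_def word_isom_apply) (simp add: shift_line_def zigzag_shift act_axis)
qed

text \<open>A compact set of times meets finitely many unit intervals, and words agreeing on those
  give lines that coincide on that set.\<close>

lemma continuous_map_shift_line:
  "continuous_map (full_shift N) (geod_topology slab sdist) (shift_line N)"
proof (rule continuous_map[THEN iffD2], intro conjI allI impI)
  have top: "\<omega> \<in> topspace (full_shift N) \<longleftrightarrow> range \<omega> \<subseteq> {..<N}" for \<omega>
    by (auto simp: PiE_iff)
  show "shift_line N ` topspace (full_shift N) \<subseteq> topspace (geod_topology slab sdist)"
    using shift_line_in_lines top by (auto simp: topspace_geod_topology)
  fix U assume U: "openin (geod_topology slab sdist) U"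
  show "openin (full_shift N) {\<omega> \<in> topspace (full_shift N). shift_line N \<omega> \<in> U}"
  proof (subst openin_subopen, intro ballI)
    fix \<omega> assume \<omega>: "\<omega> \<in> {\<omega> \<in> topspace (full_shift N). shift_line N \<omega> \<in> U}"
    then obtain K \<epsilon> where K: "compact K" "0 < \<epsilon>"
        "{c' \<in> geodesic_lines slab sdist. \<forall>t\<in>K. sdist (shift_line N \<omega> t) (c' t) < \<epsilon>} \<subseteq> U"
      using U unfolding openin_geod_topology by blast
    obtain m where m: "\<And>t. t \<in> K \<Longrightarrow> \<bar>t\<bar> \<le> m"
      using compact_imp_bounded[OF K(1)] by (auto simp: bounded_iff)
    \<comment> \<open>The index range contains the floor of every time in \<open>K\<close>. The last
      factor gives the whole shift when the range is empty, as for empty \<open>K\<close> and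
      negative \<open>m\<close>.\<close>
    define V where "V = (\<Inter>k\<in>{\<lfloor>- m\<rfloor>..\<lceil>m\<rceil>}. {\<omega>' \<in> topspace (full_shift N). \<omega>' k = \<omega> k}) \<inter> topspace (full_shift N)"
    have "openin (full_shift N) V"
      unfolding V_def
      by (intro openin_INT openin_full_shift_coordinate[where P = "\<lambda>a. a = \<omega> _"]) simp
    moreover have "\<omega> \<in> V" using \<omega> by (simp add: V_def)
    moreover have "V \<subseteq> {\<omega> \<in> topspace (full_shift N). shift_line N \<omega> \<in> U}"
    proof
      fix \<omega>' assume \<omega>': "\<omega>' \<in> V"
      then have \<omega>'_top: "\<omega>' \<in> topspace (full_shift N)" by (simp add: V_def)
      then have line: "shift_line N \<omega>' \<in> geodesic_lines slab sdist"
        using shift_line_in_lines top by blast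
      have "shift_line N \<omega>' t = shift_line N \<omega> t" if "t \<in> K" for t
      proof -
        have "- m \<le> t" "t \<le> m" using m[OF that] by (simp_all add: abs_le_iff)
        then have "\<lfloor>t\<rfloor> \<in> {\<lfloor>- m\<rfloor>..\<lceil>m\<rceil>}"
          using floor_mono[of "- m" t] by (simp add: floor_le_ceiling) linarith
        then have "\<omega>' \<lfloor>t\<rfloor> = \<omega> \<lfloor>t\<rfloor>" using \<omega>' unfolding V_def by blast
        then show ?thesis by (simp add: shift_line_def zigzag_def)
      qed
      then have "\<forall>t\<in>K. sdist (shift_line N \<omega> t) (shift_line N \<omega>' t) < \<epsilon>"
        using K(2) slab.lines_in_carrier[OF line] by (metis slab.mdist_zero)
      then show "\<omega>' \<in> {\<omega> \<in> topspace (full_shift N). shift_line N \<omega> \<in> U}"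
        using K(3) line \<omega>'_top by blast
    qed
    ultimately show "\<exists>T. openin (full_shift N) T \<and> \<omega> \<in> T \<and> T \<subseteq> {\<omega> \<in> topspace (full_shift N). shift_line N \<omega> \<in> U}"
      by blast
  qed
qed

lemma topological_entropy_slab_ge:
  assumes N: "N > 0"
  shows "topological_entropy (geod_quotient slab sdist word_group) (geod_quotient_flow 1) \<ge> ereal (ln (real N))"
proof (rule topological_entropy_ge_full_shift[where \<Psi> = "slab.line_orbit \<circ> shift_line N"])
  let ?Q = "geod_quotient slab sdist word_group"
  show "continuous_map (full_shift N) ?Q (slab.line_orbit \<circ> shift_line N)"
    unfolding geod_quotient_def
    by (rule continuous_map_compose[OF continuous_map_shift_line
          quotient_imp_continuous_map[OF quotient_map_quotient_topology]])
  show "geod_quotient_flow 1 \<in> topspace ?Q \<rightarrow> topspace ?Q"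
    using slab.continuous_map_geod_quotient_flow[of 1] by (simp add: continuous_map_def)
  show "geod_quotient_flow 1 ((slab.line_orbit \<circ> shift_line N) \<omega>) =
      (slab.line_orbit \<circ> shift_line N) (\<lambda>k. \<omega> (k + 1))" if \<omega>: "range \<omega> \<subseteq> {..<N}" for \<omega>
  proof -
    have "range (\<lambda>k. \<omega> (k + 1)) \<subseteq> {..<N}" using \<omega> by auto
    moreover have "word_isom [1] \<in> word_group" by (rule word_isom_in_group) (simp add: letters_def)
    ultimately show ?thesis
      using slab.line_orbit_translate[of "word_isom [1]" "shift_line N (\<lambda>k. \<omega> (k + 1))"] shift_line_in_lines
      by (simp add: geod_quotient_flow_orbit geod_flow_shift_line[OF \<omega>])
  qed
  show "(slab.line_orbit \<circ> shift_line N) \<omega> \<noteq> (slab.line_orbit \<circ> shift_line N) \<omega>'"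
    if \<omega>: "range \<omega> \<subseteq> {..<N}" "range \<omega>' \<subseteq> {..<N}" "\<omega> 0 \<noteq> \<omega>' 0" for \<omega> \<omega>'
  proof
    assume "(slab.line_orbit \<circ> shift_line N) \<omega> = (slab.line_orbit \<circ> shift_line N) \<omega>'"
    then obtain g where g: "g \<in> word_group" "shift_line N \<omega>' = g \<circ> shift_line N \<omega>"
      using slab.line_orbit_eqD[OF shift_line_in_lines[OF \<omega>(2)]] by auto
    obtain u where u: "g = word_isom u" using g(1) by (rule word_groupE)
    \<comment> \<open>At time \<open>1 / 2\<close> the tent over the first interval peaks at height
      \<open>\<omega> 0 / (2 * N)\<close>, and the group does not change heights.\<close>
    have "hd (shift_line N \<omega>' (1 / 2)) = hd (g (shift_line N \<omega> (1 / 2)))" by (simp add: g(2))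
    also have "\<dots> = hd (shift_line N \<omega> (1 / 2))"
      using slab.lines_in_carrier[OF shift_line_in_lines[OF \<omega>(1)]] by (simp add: u word_isom_apply)
    finally have "real (\<omega>' 0) / real N = real (\<omega> 0) / real N"
      by (simp add: shift_line_def zigzag_def frac_def)
    then show False using N \<omega>(3) by simp
  qed
qed (rule N)

lemma not_line_convex_slab: "\<not> line_convex slab sdist"
proof
  assume conv: "line_convex slab sdist"
  \<comment> \<open>The two lines agree outside the open unit interval, where one stays at height 0
    and the other rises to \<open>1 / 4\<close>.\<close>
  define \<omega> \<omega>' :: "int \<Rightarrow> nat" where "\<omega> k = 0" and "\<omega>' k = (if k = 0 then 1 else 0)" for k
  define f where "f t = sdist (shift_line 2 \<omega> t) (shift_line 2 \<omega>' t)" for t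
  have "shift_line 2 \<omega> \<in> geodesic_lines slab sdist" "shift_line 2 \<omega>' \<in> geodesic_lines slab sdist"
    by (auto intro!: shift_line_in_lines simp: \<omega>_def \<omega>'_def)
  then have "convex_on UNIV f"
    using conv unfolding line_convex_def f_def by blast
  then have "f ((1 - 1 / 2) *\<^sub>R 0 + (1 / 2) *\<^sub>R 1) \<le> (1 - 1 / 2) * f 0 + (1 / 2) * f 1"
    by (intro convex_onD) auto
  moreover have "f 0 = 0" "f 1 = 0" "f (1 / 2) = 1 / 4"
    by (simp_all add: f_def shift_line_def sdist_Cons axis_isometry zigzag_def \<omega>_def \<omega>'_def frac_def)
  ultimately show False by simp
qed

(* A proper metric space has at most the cardinality of the continuum, which is that of the
   type real list; so every isometry class of proper spaces is realised by a carrier in it. *)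
theorem theorem2:
  shows "\<exists>(M :: real list set) (d :: real list \<Rightarrow> real list \<Rightarrow> real) (\<Gamma> :: (real list \<Rightarrow> real list) set).
    Metric_space M d \<and> M \<noteq> {} \<and>
    proper_metric M d \<and> geodesic_metric M d \<and> gromov_hyperbolic M d \<and> bounded_geometry M d \<and>
    \<not> line_convex M d \<and>
    subgroup \<Gamma> (isom_group M d) \<and>
    discrete_isoms M d \<Gamma> \<and> non_elementary M d \<Gamma> \<and> cocompact M d \<Gamma> \<and>
    torsion_free (isom_subgroup M d \<Gamma>) \<and>
    metrizable_space (geod_quotient M d \<Gamma>) \<and>
    continuous_map (geod_quotient M d \<Gamma>) (geod_quotient M d \<Gamma>) (geod_quotient_flow 1) \<and>
    (\<forall>x\<in>M. topological_entropy (geod_quotient M d \<Gamma>) (geod_quotient_flow 1)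
             > critical_exponent M d \<Gamma> x)"
proof (intro exI[of _ slab] exI[of _ sdist] exI[of _ word_group] conjI ballI)
  show "Metric_space slab sdist" ..
  show "slab \<noteq> {}" using base_in_slab by blast
  show "bounded_geometry slab sdist" "cocompact slab sdist word_group"
    using slab.bounded_geometry_if_cobounded slab.cocompact_if_cobounded
      proper_slab base_in_slab cobounded_slab by blast+
  show discrete: "discrete_isoms slab sdist word_group"
    using slab.discrete_if_finite_at[OF base_in_slab word_group_growth(1)] .
  show "metrizable_space (geod_quotient slab sdist word_group)"
    using slab.metrizable_geod_quotient[OF discrete] .
  show "continuous_map (geod_quotient slab sdist word_group) (geod_quotient slab sdist word_group) (geod_quotient_flow 1)"
    by (rule slab.continuous_map_geod_quotient_flow)
  fix x assume "x \<in> slab"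
  then have "critical_exponent slab sdist word_group x \<le> ereal (ln (real 4))"
    by (intro slab.critical_exponent_le[OF word_group_growth _ base_in_slab]) auto
  \<comment> \<open>Any alphabet with more than four symbols would do.\<close>
  also have "\<dots> < ereal (ln (real 5))" by simp
  also have "\<dots> \<le> topological_entropy (geod_quotient slab sdist word_group) (geod_quotient_flow 1)"
    by (rule topological_entropy_slab_ge) simp
  finally show "critical_exponent slab sdist word_group x <
      topological_entropy (geod_quotient slab sdist word_group) (geod_quotient_flow 1)" .
qed (rule proper_slab geodesic_slab hyperbolic_slab not_line_convex_slab subgroup_word_group
    non_elementary_word_group torsion_free_word_group)+

end
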